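(* Let $L \subseteq \mathbb{N}$ be finite. Let $S$ be a c.e. or co-c.e. set of halting algorithms for computable measures on $L^{\infty}$. Suppose we are given an infinite sequence $x_1, x_2, \ldots$ of elements of $L$ which is typical (Martin-Löf random) for at least one measure whose algorithm is in $S$. Then there is an algorithm that, given access to an (co-)enumeration of $S$ and to the sequence, outputs an infinite sequence of indices $i_1, i_2, \ldots$ such that there exist $n_0$ and an index $k$ with $i_n = k$ for all $n \ge n_0$. Here $k$ indexes a computable measure in $S$ for which $x_1,x_2,\ldots$ is typical. In other words, the algorithm identifies in the limit a computable measure for which the sequence is typical. The final guess is a finite code (a Turing machine), and it is fixed after only a finite, though unknown, initial segment of the data has been read.
   Context: For a finite string $x=x_1\ldots x_n\in L^*$, the cylinder $\Gamma_x$ is the set of infinite sequences in $L^\infty$ beginning with $x$; write $\mu(x)$ for $\mu(\Gamma_x)$. A measure on $L^\infty$ is determined by values $\mu(x)$, $x\in L^*$, with $\mu(\epsilon)=1$ ($\epsilon$ the empty string) and $\mu(x)=\sum_{a\in L}\mu(xa)$ for all $x$. It is computable if there is an algorithm computing $\mu(x)$ to any rational precision given $x$. A "halting algorithm for a computable measure" is an index of such an algorithm. A set $S$ of such indices is c.e. if some algorithm lists exactly its elements. It is co-c.e. if its complement, within the standard enumeration of algorithms, is c.e. $K(x)$ denotes the prefix Kolmogorov complexity of $x$ with respect to a fixed optimal universal prefix Turing machine, with strings over $L$ encoded in binary. An infinite sequence $x_1,x_2,\ldots$ over $L$ is typical (random) for a computable measure $\mu$ iff $\sup_n \{\log \frac{1}{\mu(x_1\ldots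 x_n)} - K(x_1\ldots x_n)\} < \infty$. A sequence may be typical for several different measures. *)

theory Defs
  imports Complex_Main "HOL-Library.Extended_Real" "HOL-Library.Nat_Bijection"
    "HOL-Library.Sublist"
begin

text \<open>Programs.  Oc j queries oracle number j at the first argument.
  Zero, successor, projection, composition, primitive recursion, minimisation.\<close>
datatype recf =
    Z
  | Sc
  | Id nat
  | Cn recf "recf list"
  | Pr recf recf
  | Mn recf
  | Oc nat

definition arg :: "nat \<Rightarrow> nat list \<Rightarrow> nat" where
  "arg i xs = (if i < length xs then xs ! i else 0)"

inductive eval :: "(nat \<Rightarrow> nat \<Rightarrow> nat) \<Rightarrow> recf \<Rightarrow> nat list \<Rightarrow> nat \<Rightarrow> bool"
  for Or :: "nat \<Rightarrow> nat \<Rightarrow> nat" where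
  eval_Z:  "eval Or Z xs 0"
| eval_Sc: "eval Or Sc xs (Suc (arg 0 xs))"
| eval_Id: "eval Or (Id i) xs (arg i xs)"
| eval_Cn: "list_all2 (\<lambda>g y. eval Or g xs y) gs ys \<Longrightarrow> eval Or f ys z \<Longrightarrow> eval Or (Cn f gs) xs z"
| eval_Pr0: "eval Or f xs y \<Longrightarrow> eval Or (Pr f g) (0 # xs) y"
| eval_PrS: "eval Or (Pr f g) (n # xs) z \<Longrightarrow> eval Or g (n # z # xs) y
               \<Longrightarrow> eval Or (Pr f g) (Suc n # xs) y"
| eval_Mn: "eval Or f (y # xs) 0 \<Longrightarrow> (\<forall>z<y. \<exists>w. eval Or f (z # xs) w \<and> w \<noteq> 0)
               \<Longrightarrow> eval Or (Mn f) xs y"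
| eval_Oc: "eval Or (Oc j) xs (Or j (arg 0 xs))"
monos list_all2_mono

fun code :: "recf \<Rightarrow> nat" where
  "code Z = sum_encode (Inl 0)"
| "code Sc = sum_encode (Inl 1)"
| "code (Id i) = sum_encode (Inr (sum_encode (Inl (prod_encode (0, i)))))"
| "code (Oc j) = sum_encode (Inr (sum_encode (Inl (prod_encode (1, j)))))"
| "code (Cn f gs) = sum_encode (Inr (sum_encode (Inr (sum_encode (Inl
       (prod_encode (code f, list_encode (map code gs))))))))"
| "code (Pr f g) = sum_encode (Inr (sum_encode (Inr (sum_encode (Inr (sum_encode (Inl
       (prod_encode (code f, code g)))))))))"
| "code (Mn f) = sum_encode (Inr (sum_encode (Inr (sum_encode (Inr (sum_encode (Inr
       (code f))))))))"

definition prog :: "nat \<Rightarrow> recf" where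
  "prog e = (if \<exists>c. code c = e then (THE c. code c = e) else Z)"

definition evalp :: "nat \<Rightarrow> nat list \<Rightarrow> nat \<Rightarrow> bool" where
  "evalp e xs y \<longleftrightarrow> eval (\<lambda>_ _. 0) (prog e) xs y"

definition computable1 :: "(nat \<Rightarrow> nat) \<Rightarrow> bool" where
  "computable1 f \<longleftrightarrow> (\<exists>e. \<forall>n. evalp e [n] (f n))"

text \<open>A measure on L^infinity given by its values on cylinders.\<close>
definition cyl_measure :: "nat set \<Rightarrow> (nat list \<Rightarrow> real) \<Rightarrow> bool" where
  "cyl_measure L \<mu> \<longleftrightarrow> \<mu> [] = 1 \<and> (\<forall>x\<in>lists L. 0 \<le> \<mu> x \<and> \<mu> x = (\<Sum>a\<in>L. \<mu> (x @ [a])))"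

definition rat_of_code :: "nat \<Rightarrow> real" where
  "rat_of_code q = (case prod_decode q of (a, b) \<Rightarrow> real_of_int (int_decode a) / real (Suc b))"

definition computes_measure :: "nat set \<Rightarrow> nat \<Rightarrow> (nat list \<Rightarrow> real) \<Rightarrow> bool" where
  "computes_measure L e \<mu> \<longleftrightarrow>
     (\<forall>x\<in>lists L. \<forall>n. \<exists>q. evalp e [list_encode x, n] q \<and> \<bar>rat_of_code q - \<mu> x\<bar> \<le> 1 / 2 ^ n)"

definition halting_measure_alg :: "nat set \<Rightarrow> nat \<Rightarrow> bool" where
  "halting_measure_alg L e \<longleftrightarrow> (\<exists>\<mu>. cyl_measure L \<mu> \<and> computes_measure L e \<mu>)"

definition bcode :: "bool list \<Rightarrow> nat" where
  "bcode p = list_encode (map of_bool p)"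

definition halts_on :: "nat \<Rightarrow> bool list \<Rightarrow> bool" where
  "halts_on M p \<longleftrightarrow> (\<exists>y. evalp M [bcode p] y)"

definition prefix_machine :: "nat \<Rightarrow> bool" where
  "prefix_machine M \<longleftrightarrow> (\<forall>p q. halts_on M p \<longrightarrow> halts_on M q \<longrightarrow> prefix p q \<longrightarrow> p = q)"

text \<open>Complexity of output y w.r.t. machine M (infinity if never output).\<close>
definition KM :: "nat \<Rightarrow> nat \<Rightarrow> enat" where
  "KM M y = (INF p\<in>{p. evalp M [bcode p] y}. enat (length p))"

definition optimal_prefix_machine :: "nat \<Rightarrow> bool" where
  "optimal_prefix_machine U \<longleftrightarrow> prefix_machine U \<and>
     (\<forall>M. prefix_machine M \<longrightarrow> (\<exists>c::nat. \<forall>y. KM U y \<le> KM M y + enat c))"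

definition UK :: nat where
  "UK = (SOME U. optimal_prefix_machine U)"

definition K :: "nat list \<Rightarrow> enat" where
  "K x = KM UK (list_encode x)"

definition initseg :: "(nat \<Rightarrow> nat) \<Rightarrow> nat \<Rightarrow> nat list" where
  "initseg X n = map X [0..<n]"

definition typical :: "(nat list \<Rightarrow> real) \<Rightarrow> (nat \<Rightarrow> nat) \<Rightarrow> bool" where
  "typical \<mu> X \<longleftrightarrow> (\<exists>c::real. \<forall>n. 0 < \<mu> (initseg X n) \<and>
      ereal (log 2 (1 / \<mu> (initseg X n))) - ereal_of_enat (K (initseg X n)) \<le> ereal c)"

text \<open>The oracle algorithm M, run with oracle 0 = E (the (co-)enumeration of S)
  and oracle 1 = X (the data sequence), outputs guess i_n on input n; it is total
  and its guesses are eventually constantly k, where k is in S and indexes a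
  measure for which X is typical.\<close>
definition identifies :: "nat set \<Rightarrow> recf \<Rightarrow> nat set \<Rightarrow> (nat \<Rightarrow> nat) \<Rightarrow> (nat \<Rightarrow> nat) \<Rightarrow> bool" where
  "identifies L M S E X \<longleftrightarrow>
     (let Or = (\<lambda>j. if j = 0 then E else X) in
       (\<forall>n. \<exists>i. eval Or M [n] i) \<and>
       (\<exists>k n0. (\<forall>n\<ge>n0. eval Or M [n] k) \<and> k \<in> S \<and>
          (\<exists>\<mu>. cyl_measure L \<mu> \<and> computes_measure L k \<mu> \<and> typical \<mu> X)))"

end

theory Submission
  imports Defs
begin

text \<open>The randomness deficiency of the data with respect to a computable measure is lower
  semicomputable. A hypothesis pairs an index with a bound on its deficiency; a false hypothesis
  is refuted by a finite certificate, and in the co-c.e. case so is an index outside \<open>S\<close>.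
  The guess at stage \<open>n\<close> is the index of the least hypothesis without a refutation up to \<open>n\<close>;
  it converges to the least true hypothesis.

  Positivity of the limit measure on the data follows from bounded deficiency only because \<open>K\<close> is
  finite, so the existence of an optimal prefix machine has to be proved.\<close>

section \<open>Evaluation is deterministic\<close>

text \<open>A deficiency bound can only be refuted, never confirmed; with the bound fixed as part of
  the hypothesis, being wrong becomes semidecidable. Survival in turn means something only for a
  halting algorithm, since a diverging program yields no values to test. Hence membership in
  \<open>S\<close> is secured by the enumeration itself: either the index is read off it, or the
  listing of the complement eventually removes the index.

  The obstacle is that \<open>eval\<close> is an inductive relation without a step counter. A total
  test at each stage therefore cannot run a program for bounded time; it checks a coded derivation
  that the search supplies. The checker must itself be a total program in \<open>recf\<close>, and
  the closure rules for \<open>cmp\<close> and \<open>dcd\<close> build it up from recursion on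
  codes. The programs under test run with the zero oracle, so their certificates do not depend on
  the data.\<close>

inductive_cases eval_ZE: "eval Or Z xs y"
inductive_cases eval_ScE: "eval Or Sc xs y"
inductive_cases eval_IdE: "eval Or (Id i) xs y"
inductive_cases eval_CnE: "eval Or (Cn f gs) xs y"
inductive_cases eval_PrE: "eval Or (Pr f g) xs y"
inductive_cases eval_MnE: "eval Or (Mn f) xs y"
inductive_cases eval_OcE: "eval Or (Oc j) xs y"

lemma eval_deterministic: "eval Or r xs y \<Longrightarrow> eval Or r xs y' \<Longrightarrow> y = y'"
proof (induction arbitrary: y' rule: eval.induct)
  case (eval_Cn xs gs ys f z)
  from eval_Cn.prems obtain ys' where ys': "list_all2 (\<lambda>g y. eval Or g xs y) gs ys'" "eval Or f ys' y'"
    by (auto elim: eval_CnE)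
  have "ys = ys'"
  proof (rule nth_equalityI)
    show "length ys = length ys'"
      using list_all2_lengthD[OF eval_Cn.IH(1)] list_all2_lengthD[OF ys'(1)] by simp
    show "ys ! i = ys' ! i" if "i < length ys" for i
      using eval_Cn.IH(1) ys'(1) that by (simp add: list_all2_conv_all_nth)
  qed
  then show ?case using eval_Cn.IH(2) ys' by blast
next
  case (eval_PrS f g n xs z y)
  then show ?case by (metis eval_PrE list.inject nat.distinct(1) nat.inject)
next
  case (eval_Mn f y xs)
  from eval_Mn.prems have 1: "eval Or f (y' # xs) 0" "\<forall>z<y'. \<exists>w. eval Or f (z # xs) w \<and> w \<noteq> 0"
    by (auto elim: eval_MnE)
  \<comment> \<open>At the smaller of two distinct results of the search, the body would return both
    0 and a nonzero value.\<close>
  show ?case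
  proof (rule linorder_cases[of y y'])
    assume "y < y'" then show ?thesis using 1 eval_Mn by metis
  next
    assume "y' < y" then show ?thesis using 1 eval_Mn by metis
  qed
next
  case (eval_Pr0 f xs y g)
  from eval_Pr0.prems show ?case by (cases rule: eval_PrE) (use eval_Pr0.IH in auto)
qed (auto elim: eval_ZE eval_ScE eval_IdE eval_OcE)

section \<open>Total functionals on the naturals\<close>

text \<open>The program is chosen before the oracle, so that one algorithm serves every enumeration
  and every sequence.\<close>

definition cmp :: "((nat \<Rightarrow> nat \<Rightarrow> nat) \<Rightarrow> nat \<Rightarrow> nat) \<Rightarrow> bool" where
  "cmp F \<longleftrightarrow> (\<exists>r. \<forall>Or x. eval Or r [x] (F Or x))"

text \<open>\<open>Pr\<close> and \<open>Mn\<close> act on programs with several arguments, so a few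
  binary programs are needed before pairing can reduce everything to one argument.\<close>

definition cmp2 :: "(nat \<Rightarrow> nat \<Rightarrow> nat) \<Rightarrow> bool" where
  "cmp2 F \<longleftrightarrow> (\<exists>r. \<forall>Or x y. eval Or r [x, y] (F x y))"

definition dcd :: "((nat \<Rightarrow> nat \<Rightarrow> nat) \<Rightarrow> nat \<Rightarrow> bool) \<Rightarrow> bool" where
  "dcd P \<longleftrightarrow> cmp (\<lambda>Or x. of_bool (P Or x))"

definition pr :: "nat \<Rightarrow> nat \<Rightarrow> nat" where "pr a b = prod_encode (a, b)"
definition p1 :: "nat \<Rightarrow> nat" where "p1 z = fst (prod_decode z)"
definition p2 :: "nat \<Rightarrow> nat" where "p2 z = snd (prod_decode z)"

lemma p1_pr [simp]: "p1 (pr a b) = a" and p2_pr [simp]: "p2 (pr a b) = b"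
  and pr_p1_p2 [simp]: "pr (p1 z) (p2 z) = z"
  by (simp_all add: pr_def p1_def p2_def)

lemma pr_eq_iff [simp]: "pr a b = pr a' b' \<longleftrightarrow> a = a' \<and> b = b'"
  by (simp add: pr_def)

named_theorems cmp_intros

lemma eval_Id0: "eval Or (Id 0) (x # xs) x"
  using eval_Id[of Or 0 "x # xs"] by (simp add: arg_def)

lemma eval_Id1: "eval Or (Id (Suc 0)) (x # y # xs) y"
  using eval_Id[of Or 1 "x # y # xs"] by (simp add: arg_def)

lemma eval_Id2: "eval Or (Id (Suc (Suc 0))) (x # y # z # xs) z"
  using eval_Id[of Or 2 "x # y # z # xs"] by (simp add: arg_def numeral_2_eq_2)

lemma eval_Sc_Cons: "eval Or Sc (x # xs) (Suc x)"
  using eval_Sc[of Or "x # xs"] by (simp add: arg_def)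

lemma eval_Oc_Cons: "eval Or (Oc j) (x # xs) (Or j x)"
  using eval_Oc[of Or j "x # xs"] by (simp add: arg_def)

lemma eval_Cn1: "eval Or g xs y \<Longrightarrow> eval Or f [y] z \<Longrightarrow> eval Or (Cn f [g]) xs z"
  by (rule eval_Cn[where ys = "[y]"]) auto

lemma eval_Cn2: "eval Or g xs y \<Longrightarrow> eval Or g' xs y' \<Longrightarrow> eval Or f [y, y'] z \<Longrightarrow>
    eval Or (Cn f [g, g']) xs z"
  by (rule eval_Cn[where ys = "[y, y']"]) auto

lemma cmp2_add: "cmp2 (+)"
  unfolding cmp2_def
proof (intro exI allI)
  fix Or x y
  show "eval Or (Pr (Id 0) (Cn Sc [Id 1])) [x, y] (x + y)"
    by (induction x) (auto intro!: eval.intros(5) eval_Id0 eval_Id1 eval_Cn1 eval_Sc_Cons eval_PrS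
        simp: One_nat_def)
qed

text \<open>The arguments are swapped because \<open>Pr\<close> recurses on its first argument, and
  the recursion iterates the predecessor along the subtrahend.\<close>

lemma cmp2_monus: "cmp2 (\<lambda>x y. y - x)"
  unfolding cmp2_def
proof (intro exI allI)
  fix Or x y
  have pred: "eval Or (Pr Z (Id 0)) [n] (n - 1)" for n
    by (induction n) (auto intro!: eval_Pr0 eval_Z intro: eval_Id0 eval_PrS)
  show "eval Or (Pr (Id 0) (Cn (Pr Z (Id 0)) [Id 1])) [x, y] (y - x)"
  proof (induction x)
    case 0
    then show ?case by (auto intro!: eval_Pr0 eval_Id0)
  next
    case (Suc x)
    have "eval Or (Cn (Pr Z (Id 0)) [Id 1]) [x, y - x, y] (y - Suc x)"
      using pred[of "y - x"] by (auto intro!: eval_Cn1 eval_Id1)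
    with Suc show ?case by (rule eval_PrS)
  qed
qed

lemma eval_cmp2: "cmp2 b \<Longrightarrow> \<exists>r. \<forall>Or x y. eval Or r [x, y] (b x y)"
  by (simp add: cmp2_def)

lemma cmp_binary:
  assumes "cmp2 b" "cmp f" "cmp g"
  shows "cmp (\<lambda>Or x. b (f Or x) (g Or x))"
proof -
  obtain rb where rb: "\<And>Or x y. eval Or rb [x, y] (b x y)" using assms(1) by (auto simp: cmp2_def)
  obtain rf where rf: "\<And>Or x. eval Or rf [x] (f Or x)" using assms(2) by (auto simp: cmp_def)
  obtain rg where rg: "\<And>Or x. eval Or rg [x] (g Or x)" using assms(3) by (auto simp: cmp_def)
  show ?thesis unfolding cmp_def
    by (intro exI[of _ "Cn rb [rf, rg]"] allI eval_Cn2[OF rf rg rb])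
qed

lemma cmp_comp:
  assumes "cmp f" "cmp g"
  shows "cmp (\<lambda>Or x. f Or (g Or x))"
proof -
  obtain rf where rf: "\<And>Or x. eval Or rf [x] (f Or x)" using assms(1) by (auto simp: cmp_def)
  obtain rg where rg: "\<And>Or x. eval Or rg [x] (g Or x)" using assms(2) by (auto simp: cmp_def)
  show ?thesis unfolding cmp_def
    by (intro exI[of _ "Cn rf [rg]"] allI eval_Cn1[OF rg rf])
qed

lemma cmp_id [cmp_intros]: "cmp (\<lambda>Or x. x)"
  unfolding cmp_def by (blast intro: eval_Id0)

lemma cmp_Suc [cmp_intros]: "cmp f \<Longrightarrow> cmp (\<lambda>Or x. Suc (f Or x))"
  by (rule cmp_comp[where f = "\<lambda>_. Suc"]) (use eval_Sc_Cons in \<open>auto simp: cmp_def\<close>)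

lemma cmp_oracle [cmp_intros]: "cmp f \<Longrightarrow> cmp (\<lambda>Or x. Or j (f Or x))"
  by (rule cmp_comp[where f = "\<lambda>Or x. Or j x"])
    (auto simp: cmp_def intro!: exI[of _ "Oc j"] eval_Oc_Cons)

lemma cmp_const [cmp_intros]: "cmp (\<lambda>Or x. k)"
proof (induction k)
  case 0
  then show ?case unfolding cmp_def by (blast intro: eval_Z)
qed (rule cmp_Suc)

lemma cmp_add [cmp_intros]: "cmp f \<Longrightarrow> cmp g \<Longrightarrow> cmp (\<lambda>Or x. f Or x + g Or x)"
  by (rule cmp_binary[OF cmp2_add])

lemma cmp_minus [cmp_intros]: "cmp f \<Longrightarrow> cmp g \<Longrightarrow> cmp (\<lambda>Or x. f Or x - g Or x)"
  using cmp_binary[OF cmp2_monus, of g f] by simp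

lemma cmp_triangle: "cmp f \<Longrightarrow> cmp (\<lambda>Or x. triangle (f Or x))"
proof (rule cmp_comp[where f = "\<lambda>_. triangle"])
  obtain a where a: "\<And>Or x y. eval Or a [x, y] (x + y)" using eval_cmp2[OF cmp2_add] by auto
  have "eval Or (Pr Z (Cn a [Cn Sc [Id 0], Id 1])) [n] (triangle n)" for Or n
  proof (induction n)
    case 0
    then show ?case by (auto intro!: eval_Pr0 eval_Z)
  next
    case (Suc n)
    have "eval Or (Cn a [Cn Sc [Id 0], Id 1]) [n, triangle n] (triangle (Suc n))"
      using a[of Or "Suc n" "triangle n"]
      by (auto intro!: eval_Cn2 eval_Cn1 eval_Id0 eval_Id1 eval_Sc_Cons simp: add.commute)
    with Suc show ?case by (rule eval_PrS)
  qed
  then show "cmp (\<lambda>_. triangle)" unfolding cmp_def by blast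
qed

lemma cmp_pr [cmp_intros]: "cmp f \<Longrightarrow> cmp g \<Longrightarrow> cmp (\<lambda>Or x. pr (f Or x) (g Or x))"
  unfolding pr_def prod_encode_def by (auto intro!: cmp_intros cmp_triangle)

text \<open>Links the two worlds: composed with a unary program it yields a binary one, usable under
  \<open>Pr\<close> and \<open>Mn\<close>.\<close>

lemma cmp2_pr: "cmp2 pr"
proof -
  obtain a where a: "\<And>Or x y. eval Or a [x, y] (x + y)" using eval_cmp2[OF cmp2_add] by auto
  obtain t where t: "\<And>Or x. eval Or t [x] (triangle x)"
    using cmp_triangle[OF cmp_id] by (auto simp: cmp_def)
  have "eval Or (Cn a [Cn t [a], Id 0]) [x, y] (pr x y)" for Or x y
    unfolding pr_def prod_encode_def prod.case
    by (rule eval_Cn2[OF eval_Cn1[OF a t] eval_Id0 a])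
  then show ?thesis unfolding cmp2_def by blast
qed

text \<open>The diagonal of \<open>z\<close> is the least \<open>k\<close> with \<open>z < triangle (Suc k)\<close>; minimisation is
  used here because primitive recursion on a single coded argument already needs the projections.\<close>
lemma cmp_diagonal: "cmp (\<lambda>Or z. p1 z + p2 z)"
proof -
  obtain m where m: "\<And>Or x y. eval Or m [x, y] (y - x)" using eval_cmp2[OF cmp2_monus] by auto
  obtain t where t: "\<And>Or x. eval Or t [x] (triangle (Suc x))"
    using cmp_triangle[OF cmp_Suc[OF cmp_id]] by (auto simp: cmp_def)
  \<comment> \<open>The truncated difference vanishes exactly when
    \<open>z < triangle (Suc k)\<close>, the condition that minimisation looks for.\<close>
  have test: "eval Or (Cn m [Cn t [Id 0], Cn Sc [Id 1]]) [k, z] (Suc z - triangle (Suc k))" for Or k z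
    by (rule eval_Cn2[OF eval_Cn1[OF eval_Id0 t] eval_Cn1[OF _ eval_Sc_Cons] m]) (simp add: eval_Id1)
  have "eval Or (Mn (Cn m [Cn t [Id 0], Cn Sc [Id 1]])) [z] (p1 z + p2 z)" for Or z
  proof (rule eval_Mn)
    let ?k = "p1 z + p2 z"
    have z: "z = triangle ?k + p1 z"
      using pr_p1_p2[of z] by (simp add: pr_def prod_encode_def)
    have "z \<le> triangle ?k + ?k" using z by linarith
    then have "Suc z - triangle (Suc ?k) = 0" by simp
    then show "eval Or (Cn m [Cn t [Id 0], Cn Sc [Id 1]]) [?k, z] 0"
      using test[of Or ?k z] by simp
    have mono: "triangle i \<le> triangle j" if "i \<le> j" for i j
      using that by (induction rule: dec_induct) auto
    have "Suc z - triangle (Suc k) \<noteq> 0" if "k < ?k" for k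
      using z mono[of "Suc k" ?k] that by linarith
    then show "\<forall>k<?k. \<exists>w. eval Or (Cn m [Cn t [Id 0], Cn Sc [Id 1]]) [k, z] w \<and> w \<noteq> 0"
      using test by blast
  qed
  then show ?thesis unfolding cmp_def by blast
qed

text \<open>The pairing is Cantor's: \<open>z\<close> exceeds the triangular number of its diagonal
  by exactly \<open>p1 z\<close>.\<close>

lemma cmp_p1 [cmp_intros]: "cmp f \<Longrightarrow> cmp (\<lambda>Or x. p1 (f Or x))"
proof (rule cmp_comp[where f = "\<lambda>_. p1"])
  have "p1 z = z - triangle (p1 z + p2 z)" for z
    using pr_p1_p2[of z] by (simp add: pr_def prod_encode_def)
  then have "p1 = (\<lambda>z. z - triangle (p1 z + p2 z))" by (rule ext)
  moreover have "cmp (\<lambda>_ z. z - triangle (p1 z + p2 z))"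
    by (intro cmp_minus cmp_id cmp_triangle cmp_diagonal)
  ultimately show "cmp (\<lambda>_. p1)" by simp
qed

lemma cmp_p2 [cmp_intros]: "cmp f \<Longrightarrow> cmp (\<lambda>Or x. p2 (f Or x))"
proof (rule cmp_comp[where f = "\<lambda>_. p2"])
  have "cmp (\<lambda>_ z. (p1 z + p2 z) - p1 z)"
    by (intro cmp_minus cmp_diagonal cmp_p1 cmp_id)
  then show "cmp (\<lambda>_. p2)" by simp
qed

text \<open>Since \<open>cmp\<close> knows only unary functionals, the step function receives
  counter, previous value and parameter packed as one nested pair.\<close>

lemma cmp_rec [cmp_intros]:
  assumes f: "cmp f" and G: "cmp (\<lambda>Or p. G Or (p1 p) (p1 (p2 p)) (p2 (p2 p)))" and h: "cmp h"
  shows "cmp (\<lambda>Or x. rec_nat (f Or x) (\<lambda>n z. G Or n z x) (h Or x))"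
proof -
  obtain rf where rf: "\<And>Or x. eval Or rf [x] (f Or x)" using f by (auto simp: cmp_def)
  obtain rh where rh: "\<And>Or x. eval Or rh [x] (h Or x)" using h by (auto simp: cmp_def)
  obtain rg where rg: "\<And>Or p. eval Or rg [p] (G Or (p1 p) (p1 (p2 p)) (p2 (p2 p)))"
    using G by (auto simp: cmp_def)
  obtain e where e: "\<And>Or x y. eval Or e [x, y] (pr x y)" using cmp2_pr by (auto simp: cmp2_def)
  let ?g = "Cn rg [Cn e [Id 0, Cn e [Id 1, Id 2]]]"
  have step: "eval Or ?g [n, z, x] (G Or n z x)" for Or n z x
    using rg[of Or "pr n (pr z x)"]
    by (auto intro!: eval_Cn1[OF eval_Cn2[OF eval_Id0 eval_Cn2[OF _ _ e] e]] eval_Id1 eval_Id2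
        simp: numeral_2_eq_2)
  have "eval Or (Pr rf ?g) [m, x] (rec_nat (f Or x) (\<lambda>n z. G Or n z x) m)" for Or m x
  proof (induction m)
    case 0
    then show ?case by (auto intro!: eval_Pr0 rf)
  next
    case (Suc m)
    from eval_PrS[OF Suc step] show ?case by simp
  qed
  then have "eval Or (Cn (Pr rf ?g) [rh, Id 0]) [x] (rec_nat (f Or x) (\<lambda>n z. G Or n z x) (h Or x))" for Or x
    by (rule eval_Cn2[OF rh eval_Id0])
  then show ?thesis unfolding cmp_def by blast
qed

lemma cmp_mult [cmp_intros]:
  assumes "cmp f" "cmp g"
  shows "cmp (\<lambda>Or x. f Or x * g Or x)"
proof -
  have "a * b = rec_nat 0 (\<lambda>_ z. z + b) a" for a b :: nat
    by (induction a) auto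
  \<comment> \<open>Inside the recursion the parameter appears as \<open>p2 (p2 p)\<close>, so the
    assumption on \<open>g\<close> is used in composed form.\<close>
  then show ?thesis by (simp only:) (intro cmp_intros cmp_comp[OF assms(2)] assms)
qed

lemma cmp_power [cmp_intros]:
  assumes "cmp f" "cmp g"
  shows "cmp (\<lambda>Or x. f Or x ^ g Or x)"
proof -
  have "a ^ b = rec_nat 1 (\<lambda>_ z. z * a) b" for a b :: nat
    by (induction b) auto
  then show ?thesis by (simp only:) (intro cmp_intros cmp_comp[OF assms(1)] assms)
qed

subsection \<open>Decidable relations\<close>

lemma dcd_less [cmp_intros]: "cmp f \<Longrightarrow> cmp g \<Longrightarrow> dcd (\<lambda>Or x. f Or x < g Or x)"
proof -
  \<comment> \<open>With truncated subtraction, \<open>1 - (1 - n)\<close> is the sign of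
    \<open>n\<close>; the same device caps sums at 1 in the bounded quantifier below.\<close>
  have "of_bool (a < b) = (1 - (1 - (b - a)) :: nat)" for a b :: nat by auto
  moreover assume "cmp f" "cmp g"
  ultimately show ?thesis unfolding dcd_def by (simp only:) (intro cmp_intros)
qed

lemma dcd_not [cmp_intros]: "dcd P \<Longrightarrow> dcd (\<lambda>Or x. \<not> P Or x)"
proof -
  have "of_bool (\<not> a) = (1 - of_bool a :: nat)" for a by auto
  moreover assume "dcd P"
  ultimately show ?thesis unfolding dcd_def by (simp only:) (intro cmp_intros)
qed

lemma dcd_conj [cmp_intros]: "dcd P \<Longrightarrow> dcd Q \<Longrightarrow> dcd (\<lambda>Or x. P Or x \<and> Q Or x)"
proof -
  have "of_bool (a \<and> b) = (of_bool a * of_bool b :: nat)" for a b by auto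
  moreover assume "dcd P" "dcd Q"
  ultimately show ?thesis unfolding dcd_def by (simp only:) (intro cmp_intros)
qed

lemma dcd_disj [cmp_intros]: "dcd P \<Longrightarrow> dcd Q \<Longrightarrow> dcd (\<lambda>Or x. P Or x \<or> Q Or x)"
proof -
  assume "dcd P" "dcd Q"
  then have "dcd (\<lambda>Or x. \<not> (\<not> P Or x \<and> \<not> Q Or x))" by (intro cmp_intros)
  then show ?thesis by simp
qed

lemma dcd_imp [cmp_intros]: "dcd P \<Longrightarrow> dcd Q \<Longrightarrow> dcd (\<lambda>Or x. P Or x \<longrightarrow> Q Or x)"
proof -
  assume "dcd P" "dcd Q"
  then have "dcd (\<lambda>Or x. \<not> P Or x \<or> Q Or x)" by (intro cmp_intros)
  then show ?thesis by (simp only: imp_conv_disj)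
qed

lemma dcd_le [cmp_intros]: "cmp f \<Longrightarrow> cmp g \<Longrightarrow> dcd (\<lambda>Or x. f Or x \<le> g Or x)"
proof -
  assume "cmp f" "cmp g"
  then have "dcd (\<lambda>Or x. \<not> g Or x < f Or x)" by (intro cmp_intros)
  then show ?thesis by (simp only: not_less)
qed

lemma dcd_eq [cmp_intros]: "cmp f \<Longrightarrow> cmp g \<Longrightarrow> dcd (\<lambda>Or x. f Or x = g Or x)"
proof -
  have "a = b \<longleftrightarrow> a \<le> b \<and> b \<le> a" for a b :: nat by auto
  moreover assume "cmp f" "cmp g"
  ultimately show ?thesis by (simp only:) (intro cmp_intros)
qed

lemma dcd_comp:
  assumes "dcd P" "cmp g"
  shows "dcd (\<lambda>Or x. P Or (g Or x))"
  using assms unfolding dcd_def by (rule cmp_comp[of "\<lambda>Or x. of_bool (P Or x)"])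

lemma dcd_bex [cmp_intros]:
  assumes P: "dcd (\<lambda>Or p. P Or (p1 p) (p2 p))" and h: "cmp h"
  shows "dcd (\<lambda>Or x. \<exists>z<h Or x. P Or z x)"
proof -
  have "of_bool (\<exists>z<n. P Or z x) = rec_nat (0 :: nat) (\<lambda>z r. Suc 0 - (Suc 0 - (r + of_bool (P Or z x)))) n" for Or x n
  proof (induction n)
    case (Suc n)
    then show ?case by (auto simp: Suc[symmetric] less_Suc_eq)
  qed simp
  moreover have "cmp (\<lambda>Or x. rec_nat 0 (\<lambda>z r. Suc 0 - (Suc 0 - (r + of_bool (P Or z x)))) (h Or x))"
    \<comment> \<open>The recursion supplies counter, value and parameter, while the predicate takes
      only counter and parameter; the triple is repacked accordingly.\<close>
    by (intro cmp_intros h cmp_comp[OF P[unfolded dcd_def], of "\<lambda>Or p. pr (p1 p) (p2 (p2 p))", simplified])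
  ultimately show ?thesis unfolding dcd_def by (simp only:)
qed

lemma dcd_ball [cmp_intros]:
  assumes P: "dcd (\<lambda>Or p. P Or (p1 p) (p2 p))" and h: "cmp h"
  shows "dcd (\<lambda>Or x. \<forall>z<h Or x. P Or z x)"
  using dcd_not[OF dcd_bex[OF dcd_not[OF P] h]] by simp

subsection \<open>Coded lists\<close>

definition nthc :: "nat \<Rightarrow> nat \<Rightarrow> nat" where "nthc c i = arg i (list_decode c)"
definition lenc :: "nat \<Rightarrow> nat" where "lenc c = length (list_decode c)"
definition consc :: "nat \<Rightarrow> nat \<Rightarrow> nat" where "consc a c = Suc (pr a c)"
definition dropc :: "nat \<Rightarrow> nat \<Rightarrow> nat" where "dropc n c = list_encode (drop n (list_decode c))"

lemma consc_list_encode [simp]: "consc a (list_encode xs) = list_encode (a # xs)"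
  by (simp add: consc_def pr_def)

lemma list_decode_consc [simp]: "list_decode (consc a c) = a # list_decode c"
  by (metis consc_list_encode list_encode_inverse list_decode_inverse)

lemma list_decode_dropc [simp]: "list_decode (dropc n c) = drop n (list_decode c)"
  by (simp add: dropc_def)

text \<open>The empty list has code 0 and \<open>0 - 1 = 0\<close>, so these values let the
  arithmetic formulas for head and tail agree with the defaults on the empty list.\<close>

lemma p1_0 [simp]: "p1 0 = 0" and p2_0 [simp]: "p2 0 = 0"
proof -
  have "pr 0 0 = 0" by (simp add: pr_def prod_encode_def)
  then show "p1 0 = 0" "p2 0 = 0" using p1_pr[of 0 0] p2_pr[of 0 0] by simp_all
qed

lemma list_decode_Suc: "list_decode (Suc n) = p1 n # list_decode (p2 n)"
  by (simp add: p1_def p2_def split: prod.split)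

lemma tl_code: "list_encode (tl (list_decode c)) = p2 (c - 1)"
  by (cases c) (simp_all add: list_decode_Suc del: list_decode.simps(2))

lemma hd_code: "nthc c 0 = p1 (c - 1)"
  by (cases c) (simp_all add: nthc_def arg_def list_decode_Suc del: list_decode.simps(2))

lemma cmp_consc [cmp_intros]: "cmp f \<Longrightarrow> cmp g \<Longrightarrow> cmp (\<lambda>Or x. consc (f Or x) (g Or x))"
  unfolding consc_def by (intro cmp_intros)

lemma cmp_dropc [cmp_intros]:
  assumes "cmp f" "cmp g"
  shows "cmp (\<lambda>Or x. dropc (f Or x) (g Or x))"
proof -
  have "dropc n c = rec_nat c (\<lambda>_ z. p2 (z - 1)) n" for n c
  proof (induction n)
    case (Suc n)
    have "dropc (Suc n) c = list_encode (tl (list_decode (dropc n c)))"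
      by (simp add: dropc_def drop_Suc tl_drop)
    then show ?case using Suc by (simp only: tl_code) simp
  qed (simp add: dropc_def)
  then show ?thesis by (simp only:) (intro cmp_intros assms)
qed

lemma cmp_nthc [cmp_intros]:
  assumes "cmp f" "cmp g"
  shows "cmp (\<lambda>Or x. nthc (f Or x) (g Or x))"
proof -
  have "nthc c n = nthc (dropc n c) 0" for n c
    by (simp add: nthc_def arg_def)
  then have "nthc c n = p1 (dropc n c - 1)" for n c
    by (simp only: hd_code)
  then show ?thesis by (simp only:) (intro cmp_intros assms)
qed

text \<open>The length is the number of nonempty suffixes. Counting up to \<open>c\<close> is
  enough, because a list is never longer than its code.\<close>

lemma cmp_lenc [cmp_intros]:
  assumes "cmp f"
  shows "cmp (\<lambda>Or x. lenc (f Or x))"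
proof -
  have "list_encode xs = 0 \<longleftrightarrow> xs = []" for xs by (cases xs) simp_all
  then have drop0: "dropc i c = 0 \<longleftrightarrow> lenc c \<le> i" for i c by (simp add: dropc_def lenc_def)
  have len_le: "length xs \<le> list_encode xs" for xs
    by (induction xs) (auto intro: order_trans[OF _ le_prod_encode_2])
  have "rec_nat 0 (\<lambda>i z. z + (1 - (1 - dropc i c))) n = min n (lenc c)" for n c
  proof (induction n)
    case (Suc n)
    then show ?case using drop0[of n c] by (cases "lenc c \<le> n") simp_all
  qed simp
  moreover have "lenc c \<le> c" for c using len_le[of "list_decode c"] by (simp add: lenc_def)
  ultimately have "lenc c = rec_nat 0 (\<lambda>i z. z + (1 - (1 - dropc i c))) c" for c by simp
  then show ?thesis by (simp only:) (intro cmp_intros cmp_comp[OF assms] assms)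
qed

section \<open>Unbounded search\<close>

text \<open>An equivalence rather than mere evaluation: prefix-freeness of a machine built by search
  also needs to know where the search diverges.\<close>

lemma search_program:
  assumes P: "dcd (\<lambda>Or p. P Or (p1 p) (p2 p))" and out: "cmp out"
  obtains r where "\<And>Or x y. eval Or r [x] y \<longleftrightarrow>
    (\<exists>m. P Or m x \<and> (\<forall>z<m. \<not> P Or z x) \<and> y = out Or m)"
proof -
  obtain t where t: "\<And>Or p. eval Or t [p] (of_bool (\<not> P Or (p1 p) (p2 p)))"
    using dcd_not[OF P] by (auto simp: cmp_def dcd_def)
  obtain o' where o': "\<And>Or x. eval Or o' [x] (out Or x)" using out by (auto simp: cmp_def)
  obtain e where e: "\<And>Or x y. eval Or e [x, y] (pr x y)" using cmp2_pr by (auto simp: cmp2_def)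
  define q where "q = Cn t [e]"
  have q: "eval Or q [m, x] (of_bool (\<not> P Or m x))" for Or m x
    using eval_Cn1[OF e t, of Or m x] by (simp add: q_def)
  have q_iff: "eval Or q [m, x] w \<longleftrightarrow> w = of_bool (\<not> P Or m x)" for Or m x w
    using q eval_deterministic by metis
  have Mn_iff: "eval Or (Mn q) [x] m \<longleftrightarrow> P Or m x \<and> (\<forall>z<m. \<not> P Or z x)" for Or x m
  proof
    assume "eval Or (Mn q) [x] m"
    then show "P Or m x \<and> (\<forall>z<m. \<not> P Or z x)" by (auto elim!: eval_MnE simp: q_iff split: if_splits)
  next
    assume "P Or m x \<and> (\<forall>z<m. \<not> P Or z x)"
    then show "eval Or (Mn q) [x] m" by (intro eval_Mn) (auto simp: q_iff)
  qed
  show thesis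
  proof (rule that)
    fix Or x y
    show "eval Or (Cn o' [Mn q]) [x] y \<longleftrightarrow> (\<exists>m. P Or m x \<and> (\<forall>z<m. \<not> P Or z x) \<and> y = out Or m)"
      (is "_ \<longleftrightarrow> ?R")
    proof
      assume "eval Or (Cn o' [Mn q]) [x] y"
      then obtain m where m: "eval Or (Mn q) [x] m" "eval Or o' [m] y"
        by (auto elim!: eval_CnE simp: list_all2_Cons1)
      then show ?R using eval_deterministic[OF m(2) o'] Mn_iff by blast
    next
      assume ?R
      then obtain m where "eval Or (Mn q) [x] m" "y = out Or m" using Mn_iff by blast
      then show "eval Or (Cn o' [Mn q]) [x] y" using eval_Cn1 o' by simp
    qed
  qed
qed

section \<open>Decidable certificates of evaluations\<close>

definition cZ :: nat where "cZ = sum_encode (Inl 0)"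
definition cSc :: nat where "cSc = sum_encode (Inl 1)"
definition cId :: "nat \<Rightarrow> nat" where
  "cId i = sum_encode (Inr (sum_encode (Inl (pr 0 i))))"
definition cOc :: "nat \<Rightarrow> nat" where
  "cOc j = sum_encode (Inr (sum_encode (Inl (pr 1 j))))"
definition cCn :: "nat \<Rightarrow> nat \<Rightarrow> nat" where
  "cCn a b = sum_encode (Inr (sum_encode (Inr (sum_encode (Inl (pr a b))))))"
definition cPr :: "nat \<Rightarrow> nat \<Rightarrow> nat" where
  "cPr a b = sum_encode (Inr (sum_encode (Inr (sum_encode (Inr (sum_encode (Inl (pr a b))))))))"
definition cMn :: "nat \<Rightarrow> nat" where
  "cMn a = sum_encode (Inr (sum_encode (Inr (sum_encode (Inr (sum_encode (Inr a)))))))"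

lemmas code_constr_defs = cZ_def cSc_def cId_def cOc_def cCn_def cPr_def cMn_def

lemma code_constr:
  "code Z = cZ" "code Sc = cSc" "code (Id i) = cId i" "code (Oc j) = cOc j"
  "code (Cn f gs) = cCn (code f) (list_encode (map code gs))"
  "code (Pr f g) = cPr (code f) (code g)" "code (Mn f) = cMn (code f)"
  by (simp_all add: code_constr_defs pr_def)

text \<open>Listing the constructors in both orders gives the simplifier each inequation in both
  orientations.\<close>

lemma code_constr_distinct:
  "distinct [cZ, cSc, cId i, cOc j, cCn a b, cPr c d, cMn e]"
  "distinct [cMn e, cPr c d, cCn a b, cOc j, cId i, cSc, cZ]"
  "cCn a b = cCn a' b' \<longleftrightarrow> a = a' \<and> b = b'" "cPr a b = cPr a' b' \<longleftrightarrow> a = a' \<and> b = b'"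
  "cMn a = cMn a' \<longleftrightarrow> a = a'" "cId i = cId i' \<longleftrightarrow> i = i'" "cOc i = cOc i' \<longleftrightarrow> i = i'"
  by (simp_all add: code_constr_defs sum_encode_eq)

lemmas code_constr_simps [simp] = code_constr_distinct[simplified distinct.simps list.set, simplified]

lemma code_eq_iff [simp]: "code r = code s \<longleftrightarrow> r = s"
proof
  show "code r = code s \<Longrightarrow> r = s"
  proof (induction r arbitrary: s)
    case (Cn f gs)
    then obtain f' gs' where s: "s = Cn f' gs'"
      by (cases s) (auto simp: code_constr simp del: code.simps)
    have "f = f'" using Cn s by (simp add: code_constr del: code.simps)
    moreover have "map code gs = map code gs'"
      using Cn.prems s by (simp add: code_constr list_encode_eq del: code.simps)
    then have "gs = gs'"
      by (rule list.inj_map_strong[rotated]) (use Cn.IH(2) in blast)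
    ultimately show ?case using s by simp
  qed (case_tac s; simp add: code_constr del: code.simps)+
qed simp

lemma prog_code [simp]: "prog (code r) = r"
  by (auto simp: prog_def)

lemma evalp_code: "evalp (code r) xs y \<longleftrightarrow> eval (\<lambda>_ _. 0) r xs y"
  by (simp add: evalp_def)

lemma evalp_deterministic: "evalp e xs y \<Longrightarrow> evalp e xs y' \<Longrightarrow> y = y'"
  unfolding evalp_def by (rule eval_deterministic)

section \<open>Derivations of evaluation statements\<close>

definition trip :: "nat \<Rightarrow> nat \<Rightarrow> nat \<Rightarrow> nat" where "trip e xs y = pr e (pr xs y)"

lemma trip_eq_iff [simp]: "trip e xs y = trip e' xs' y' \<longleftrightarrow> e = e' \<and> xs = xs' \<and> y = y'"
  by (simp add: trip_def)

text \<open>The statement \<open>trip e xs y\<close> (program \<open>e\<close> maps the coded list \<open>xs\<close> to \<open>y\<close>) follows by one rule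
  from statements in \<open>P\<close>. The hints \<open>a\<close>, \<open>b\<close> are the immediate subprograms; \<open>d\<close> lists the
  intermediate values.\<close>
definition justified :: "(nat \<Rightarrow> bool) \<Rightarrow> nat \<Rightarrow> nat \<Rightarrow> nat \<Rightarrow> nat \<Rightarrow> nat \<Rightarrow> nat \<Rightarrow> bool" where
  "justified P e xs y a b d \<longleftrightarrow>
     e = cZ \<and> y = 0 \<or>
     e = cSc \<and> y = Suc (nthc xs 0) \<or>
     e = cId a \<and> y = nthc xs a \<or>
     e = cOc a \<and> y = 0 \<or>
     e = cCn a b \<and> lenc d = lenc b \<and> (\<forall>i<lenc b. P (trip (nthc b i) xs (nthc d i))) \<and> P (trip a d y) \<or>
     e = cPr a b \<and> 0 < xs \<and> nthc xs 0 = 0 \<and> P (trip a (dropc 1 xs) y) \<or>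
     e = cPr a b \<and> 0 < xs \<and> 0 < nthc xs 0 \<and>
       P (trip e (consc (nthc xs 0 - 1) (dropc 1 xs)) d) \<and>
       P (trip b (consc (nthc xs 0 - 1) (consc d (dropc 1 xs))) y) \<or>
     e = cMn a \<and> P (trip a (consc y xs) 0) \<and>
       (\<forall>z<y. 0 < nthc d z \<and> P (trip a (consc z xs) (nthc d z)))"

lemma justified_mono:
  assumes "justified P e xs y a b d" "\<And>t. P t \<Longrightarrow> Q t"
  shows "justified Q e xs y a b d"
  using assms(1) unfolding justified_def by (elim disjE) (auto simp: assms(2))

definition step_ok :: "(nat \<Rightarrow> bool) \<Rightarrow> nat \<Rightarrow> bool" where
  "step_ok P s \<longleftrightarrow> justified P (p1 (p1 s)) (p1 (p2 (p1 s))) (p2 (p2 (p1 s)))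
     (p1 (p2 s)) (p1 (p2 (p2 s))) (p2 (p2 (p2 s)))"

lemma step_ok_pr: "step_ok P (pr (trip e xs y) (pr a (pr b d))) \<longleftrightarrow> justified P e xs y a b d"
  by (simp add: step_ok_def trip_def)

text \<open>Each entry may use only entries behind it, which excludes circular
  justifications.\<close>

fun derivation :: "nat list \<Rightarrow> bool" where
  "derivation [] \<longleftrightarrow> True"
| "derivation (s # c) \<longleftrightarrow> step_ok (\<lambda>t. t \<in> p1 ` set c) s \<and> derivation c"

definition derivable :: "nat \<Rightarrow> bool" where
  "derivable t \<longleftrightarrow> (\<exists>c. derivation c \<and> t \<in> p1 ` set c)"

lemma derivation_append: "derivation c \<Longrightarrow> derivation c' \<Longrightarrow> derivation (c @ c')"
  by (induction c) (auto simp: step_ok_def elim!: justified_mono)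

lemma derivable_finite:
  assumes "finite A" "\<And>t. t \<in> A \<Longrightarrow> derivable t"
  obtains c where "derivation c" "A \<subseteq> p1 ` set c"
proof -
  from assms have "\<exists>c. derivation c \<and> A \<subseteq> p1 ` set c"
  proof (induction A rule: finite_induct)
    case empty
    then show ?case by (auto intro: exI[of _ "[]"])
  next
    case (insert t A)
    then obtain c c' where "derivation c" "A \<subseteq> p1 ` set c" "derivation c'" "t \<in> p1 ` set c'"
      unfolding derivable_def by (metis insertCI)
    then show ?case by (intro exI[of _ "c @ c'"]) (auto simp: derivation_append)
  qed
  then show thesis using that by blast
qed

lemma derivable_step:
  assumes "finite A" "\<And>t. t \<in> A \<Longrightarrow> derivable t" "justified (\<lambda>t. t \<in> A) e xs y a b d"
  shows "derivable (trip e xs y)"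
proof -
  obtain c where c: "derivation c" "A \<subseteq> p1 ` set c" using derivable_finite assms(1,2) by metis
  have "justified (\<lambda>t. t \<in> p1 ` set c) e xs y a b d"
    using assms(3) c(2) by (auto elim: justified_mono)
  then have "derivation (pr (trip e xs y) (pr a (pr b d)) # c)"
    using c(1) by (simp add: step_ok_pr)
  then show ?thesis unfolding derivable_def
    by (intro exI[of _ "pr (trip e xs y) (pr a (pr b d)) # c"]) auto
qed

lemma nthc_list_encode [simp]: "nthc (list_encode xs) i = arg i xs"
  and lenc_list_encode [simp]: "lenc (list_encode xs) = length xs"
  and dropc_list_encode [simp]: "dropc n (list_encode xs) = list_encode (drop n xs)"
  by (simp_all add: nthc_def lenc_def dropc_def)

lemma list_encode_pos: "0 < list_encode xs \<longleftrightarrow> xs \<noteq> []"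
  by (cases xs) auto

lemma arg_Cons_0 [simp]: "arg 0 (x # xs) = x"
  by (simp add: arg_def)

lemma arg_nth [simp]: "i < length xs \<Longrightarrow> arg i xs = xs ! i"
  by (simp add: arg_def)

lemma eval_imp_derivable:
  "eval Or r xs y \<Longrightarrow> Or = (\<lambda>_ _. 0) \<Longrightarrow> derivable (trip (code r) (list_encode xs) y)"
proof (induction rule: eval.induct)
  case (eval_Z xs)
  show ?case
    by (rule derivable_step[of "{}"]) (simp_all add: justified_def code_constr del: code.simps)
next
  case (eval_Sc xs)
  show ?case
    by (rule derivable_step[of "{}"]) (simp_all add: justified_def code_constr del: code.simps)
next
  case (eval_Id i xs)
  show ?case
    by (rule derivable_step[of "{}" _ _ _ i])
      (simp_all add: justified_def code_constr del: code.simps)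
next
  case (eval_Oc j xs)
  then show ?case
    by (intro derivable_step[of "{}" _ _ _ j])
      (simp_all add: justified_def code_constr del: code.simps)
next
  case (eval_Cn xs gs ys f z)
  let ?A = "insert (trip (code f) (list_encode ys) z)
    ((\<lambda>i. trip (code (gs ! i)) (list_encode xs) (ys ! i)) ` {..<length gs})"
  show ?case
    by (rule derivable_step[of ?A _ _ _ "code f" "list_encode (map code gs)" "list_encode ys"])
      (use eval_Cn in \<open>auto simp: justified_def code_constr list_all2_conv_all_nth simp del: code.simps\<close>)
next
  case (eval_Pr0 f xs y g)
  then show ?case
    by (intro derivable_step[of "{trip (code f) (list_encode xs) y}" _ _ _ "code f" "code g"])
      (simp_all add: justified_def code_constr list_encode_pos del: code.simps list_encode.simps)
next
  case (eval_PrS f g n xs z y)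
  then show ?case
    by (intro derivable_step[of "{trip (code (Pr f g)) (list_encode (n # xs)) z,
          trip (code g) (list_encode (n # z # xs)) y}" _ _ _ "code f" "code g" z])
      (auto simp: justified_def code_constr list_encode_pos simp del: code.simps list_encode.simps)
next
  case (eval_Mn f y xs)
  \<comment> \<open>Choice collects the nonzero values at all arguments below \<open>y\<close>;
    their list becomes the hint \<open>d\<close>.\<close>
  then obtain w where w: "\<And>z. z < y \<Longrightarrow> derivable (trip (code f) (list_encode (z # xs)) (w z)) \<and> w z \<noteq> 0"
    by metis
  let ?A = "insert (trip (code f) (list_encode (y # xs)) 0)
    ((\<lambda>z. trip (code f) (list_encode (z # xs)) (w z)) ` {..<y})"
  show ?case
    by (rule derivable_step[of ?A _ _ _ "code f" _ "list_encode (map w [0..<y])"])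
      (use w eval_Mn in \<open>auto simp: justified_def code_constr simp del: code.simps list_encode.simps\<close>)
qed

text \<open>Induction on the list, with all statements of the tail already true. Distinctness of the
  code constructors leaves only the clauses matching the shape of \<open>r\<close>, and their
  injectivity identifies the hints with its subprograms.\<close>

lemma derivation_sound:
  assumes "derivation c" "s \<in> set c" "p1 s = trip (code r) xs y"
  shows "eval (\<lambda>_ _. 0) r (list_decode xs) y"
  using assms
proof (induction c arbitrary: s r xs y)
  case (Cons s' c)
  define E where "E = (\<lambda>t. t \<in> p1 ` set c)"
  have E: "eval (\<lambda>_ _. 0) r (list_decode xs) y" if "E (trip (code r) xs y)" for r xs y
    using Cons that by (auto simp: E_def)
  show ?case
  proof (cases "s \<in> set c")
    case True
    then show ?thesis using Cons by simp
  next
    case False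
    with Cons.prems have s: "step_ok E s" by (auto simp: E_def)
    define a b d where "a = p1 (p2 s)" and "b = p1 (p2 (p2 s))" and "d = p2 (p2 (p2 s))"
    have j: "justified E (code r) xs y a b d"
      using s Cons.prems(3) by (simp add: step_ok_def trip_def a_def b_def d_def)
    obtain xl where xl: "xs = list_encode xl" by (metis list_decode_inverse)
    show ?thesis
    proof (cases r)
      case Z
      then show ?thesis using j by (auto simp: justified_def code_constr simp del: code.simps intro: eval_Z)
    next
      case Sc
      then show ?thesis using j
        by (auto simp: justified_def code_constr xl simp del: code.simps intro: eval_Sc)
    next
      case (Id i)
      then show ?thesis using j
        by (auto simp: justified_def code_constr xl simp del: code.simps intro: eval_Id)
    next
      case (Oc i)
      then show ?thesis using j eval_Oc[of "\<lambda>_ _. 0" i xl]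
        by (auto simp: justified_def code_constr xl simp del: code.simps)
    next
      case (Cn f gs)
      then have ab: "a = code f" "b = list_encode (map code gs)" and dl: "lenc d = length gs"
        and g: "\<And>i. i < length gs \<Longrightarrow> E (trip (code (gs ! i)) xs (nthc d i))"
        and f: "E (trip (code f) d y)"
        using j by (auto simp: justified_def code_constr simp del: code.simps)
      have "list_all2 (\<lambda>g y. eval (\<lambda>_ _. 0) g (list_decode xs) y) gs (list_decode d)"
        using E[OF g] dl by (auto simp: list_all2_conv_all_nth lenc_def nthc_def)
      then show ?thesis using E[OF f] Cn by (auto intro: eval_Cn)
    next
      case (Pr f g)
      then have ab: "a = code f" "b = code g" and x: "0 < xs"
        and or: "nthc xs 0 = 0 \<and> E (trip (code f) (dropc 1 xs) y) \<or>
          0 < nthc xs 0 \<and> E (trip (code r) (consc (nthc xs 0 - 1) (dropc 1 xs)) d) \<and>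
           E (trip (code g) (consc (nthc xs 0 - 1) (consc d (dropc 1 xs))) y)"
        using j by (auto simp: justified_def code_constr simp del: code.simps)
      from x xl obtain n xt where n: "xl = n # xt" by (cases xl) auto
      show ?thesis
      proof (cases n)
        case 0
        then show ?thesis using or E Pr n xl by (force intro: eval_Pr0 simp del: list_encode.simps code.simps)
      next
        case (Suc m)
        then have "E (trip (code r) (list_encode (m # xt)) d)" "E (trip (code g) (list_encode (m # d # xt)) y)"
          using or n xl by (auto simp del: list_encode.simps code.simps)
        from E[OF this(1)] E[OF this(2)] show ?thesis
          using Suc n xl Pr by (auto intro: eval_PrS simp del: list_encode.simps code.simps)
      qed
    next
      case (Mn f)
      then have f: "E (trip (code f) (consc y xs) 0)"
        and z: "\<And>z. z < y \<Longrightarrow> 0 < nthc d z \<and> E (trip (code f) (consc z xs) (nthc d z))"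
        using j by (auto simp: justified_def code_constr simp del: code.simps)
      have "\<exists>w. eval (\<lambda>_ _. 0) f (u # list_decode xs) w \<and> w \<noteq> 0" if "u < y" for u
        using z[OF that] E[of f "consc u xs" "nthc d u"] by auto
      then show ?thesis using E[OF f] Mn by (auto intro!: eval_Mn)
    qed
  qed
qed simp

definition cert :: "nat \<Rightarrow> nat \<Rightarrow> nat \<Rightarrow> nat \<Rightarrow> bool" where
  "cert e xs y c \<longleftrightarrow> derivation (list_decode c) \<and> trip e xs y \<in> p1 ` set (list_decode c)"

text \<open>A number that codes no program runs as \<open>Z\<close>, which certificates ignore; such a number is
  neither a prefix machine nor a halting measure algorithm.\<close>
lemma evalp_iff_cert: "evalp (code r) xs y \<longleftrightarrow> (\<exists>c. cert (code r) (list_encode xs) y c)"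
proof
  assume "evalp (code r) xs y"
  then have "derivable (trip (code r) (list_encode xs) y)" by (simp add: evalp_code eval_imp_derivable)
  then show "\<exists>c. cert (code r) (list_encode xs) y c"
    unfolding derivable_def cert_def by (metis list_encode_inverse)
next
  assume "\<exists>c. cert (code r) (list_encode xs) y c"
  then obtain c s where "derivation (list_decode c)" "s \<in> set (list_decode c)"
    "p1 s = trip (code r) (list_encode xs) y" unfolding cert_def by force
  from derivation_sound[OF this] show "evalp (code r) xs y" by (simp add: evalp_code)
qed

section \<open>Certificates expressed by bounded quantifiers\<close>

definition stated :: "nat \<Rightarrow> nat \<Rightarrow> nat \<Rightarrow> bool" where
  "stated c i t \<longleftrightarrow> (\<exists>j<lenc c. i < j \<and> p1 (nthc c j) = t)"

lemma stated_iff: "stated c i t \<longleftrightarrow> t \<in> p1 ` set (drop (Suc i) (list_decode c))"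
proof -
  have "t \<in> p1 ` set (drop (Suc i) xs) \<longleftrightarrow> (\<exists>j<length xs. i < j \<and> p1 (xs ! j) = t)" for xs
  proof
    assume "t \<in> p1 ` set (drop (Suc i) xs)"
    then obtain k where "k < length xs - Suc i" "t = p1 (xs ! (Suc i + k))"
      by (auto simp: in_set_conv_nth)
    then show "\<exists>j<length xs. i < j \<and> p1 (xs ! j) = t"
      by (intro exI[of _ "Suc i + k"]) auto
  next
    assume "\<exists>j<length xs. i < j \<and> p1 (xs ! j) = t"
    then obtain j where j: "j < length xs" "i < j" "p1 (xs ! j) = t" by blast
    then have "xs ! j = drop (Suc i) xs ! (j - Suc i)" "j - Suc i < length (drop (Suc i) xs)" by auto
    then show "t \<in> p1 ` set (drop (Suc i) xs)" using j(3) nth_mem by (metis imageI)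
  qed
  from this[of "list_decode c"] show ?thesis
    unfolding stated_def by (metis arg_nth lenc_def nthc_def)
qed

lemma derivation_iff:
  "derivation c \<longleftrightarrow> (\<forall>i<length c. step_ok (\<lambda>t. t \<in> p1 ` set (drop (Suc i) c)) (c ! i))"
  by (induction c) (auto simp: less_Suc_eq_0_disj)

text \<open>Positions replace sets and suffixes, so that every quantifier is bounded and the closure
  rules of \<open>dcd\<close> apply.\<close>

lemma cert_iff:
  "cert e xs y c \<longleftrightarrow> (\<forall>i<lenc c. step_ok (stated c i) (nthc c i)) \<and>
     (\<exists>j<lenc c. p1 (nthc c j) = trip e xs y)"
proof -
  have "derivation (list_decode c) \<longleftrightarrow> (\<forall>i<lenc c. step_ok (stated c i) (nthc c i))"
    unfolding derivation_iff lenc_def by (simp add: stated_iff[abs_def] nthc_def)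
  moreover have "t \<in> p1 ` set (list_decode c) \<longleftrightarrow> (\<exists>j<lenc c. p1 (nthc c j) = t)" for t
  proof -
    have "t \<in> p1 ` set xs \<longleftrightarrow> (\<exists>j<length xs. p1 (xs ! j) = t)" for xs
      by (auto simp: set_conv_nth)
    then show ?thesis by (simp add: lenc_def nthc_def cong: conj_cong)
  qed
  ultimately show ?thesis by (simp add: cert_def)
qed

lemma cmp_trip [cmp_intros]:
  "cmp f \<Longrightarrow> cmp g \<Longrightarrow> cmp h \<Longrightarrow> cmp (\<lambda>Or x. trip (f Or x) (g Or x) (h Or x))"
  unfolding trip_def by (intro cmp_intros)

lemma cmp_code_constr [cmp_intros]:
  assumes "cmp f"
  shows "cmp (\<lambda>Or x. cId (f Or x))" "cmp (\<lambda>Or x. cOc (f Or x))" "cmp (\<lambda>Or x. cMn (f Or x))"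
    "cmp g \<Longrightarrow> cmp (\<lambda>Or x. cCn (f Or x) (g Or x))" "cmp g \<Longrightarrow> cmp (\<lambda>Or x. cPr (f Or x) (g Or x))"
  unfolding code_constr_defs sum_encode_def sum.case by (intro cmp_intros assms, assumption?)+

lemma dcd_cert [cmp_intros]:
  assumes "cmp e" "cmp xs" "cmp y" "cmp c"
  shows "dcd (\<lambda>Or x. cert (e Or x) (xs Or x) (y Or x) (c Or x))"
  unfolding cert_iff step_ok_def justified_def stated_def
  by (intro cmp_intros cmp_comp[OF assms(1)] cmp_comp[OF assms(2)] cmp_comp[OF assms(3)]
      cmp_comp[OF assms(4)] assms)

section \<open>An optimal prefix machine\<close>

definition bitsc :: "nat \<Rightarrow> bool" where "bitsc q \<longleftrightarrow> (\<forall>i<lenc q. nthc q i \<le> 1)"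

lemma lenc_bcode [simp]: "lenc (bcode p) = length p"
  and dropc_bcode [simp]: "dropc n (bcode p) = bcode (drop n p)"
  and nthc_bcode [simp]: "i < length p \<Longrightarrow> nthc (bcode p) i = of_bool (p ! i)"
  by (simp_all add: bcode_def drop_map)

lemma bcode_eq_iff [simp]: "bcode p = bcode q \<longleftrightarrow> p = q"
  by (auto simp: bcode_def list_encode_eq inj_map_eq_map inj_def)

lemma bitsc_iff: "bitsc q \<longleftrightarrow> (\<exists>p. q = bcode p)"
proof
  assume q: "bitsc q"
  let ?p = "map (\<lambda>a. 0 < a) (list_decode q)"
  have "list_decode q = map of_bool ?p"
    using q by (intro nth_equalityI) (auto simp: bitsc_def lenc_def nthc_def le_Suc_eq)
  then show "\<exists>p. q = bcode p" unfolding bcode_def by (metis list_decode_inverse)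
qed (auto simp: bitsc_def)

text \<open>Comparability in the prefix order, phrased by positions to be decidable on
  codes.\<close>

definition compat :: "nat \<Rightarrow> nat \<Rightarrow> bool" where
  "compat q q' \<longleftrightarrow> (\<forall>i<lenc q. i < lenc q' \<longrightarrow> nthc q i = nthc q' i)"

lemma prefix_iff_nth: "prefix p q \<longleftrightarrow> length p \<le> length q \<and> (\<forall>i<length p. p ! i = q ! i)"
proof
  assume "length p \<le> length q \<and> (\<forall>i<length p. p ! i = q ! i)"
  then have "p = take (length p) q" by (intro nth_equalityI) auto
  then show "prefix p q" by (metis take_is_prefix)
qed (auto simp: prefix_def nth_append)

lemma compat_bcode: "compat (bcode p) (bcode q) \<longleftrightarrow> prefix p q \<or> prefix q p"
proof -
  have "compat (bcode p) (bcode q) \<longleftrightarrow> (\<forall>i<length p. i < length q \<longrightarrow> p ! i = q ! i)"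
    by (simp add: compat_def) blast
  then show ?thesis by (cases "length p \<le> length q") (auto simp: prefix_iff_nth)
qed

text \<open>\<open>j\<close> codes a program for machine \<open>e\<close>, together with its output and a certificate.\<close>
definition run :: "nat \<Rightarrow> nat \<Rightarrow> bool" where
  "run e j \<longleftrightarrow> bitsc (p1 j) \<and> cert e (consc (p1 j) 0) (p1 (p2 j)) (p2 (p2 j))"

text \<open>Turns any machine \<open>e\<close> into a prefix machine: the run \<open>j\<close> of program \<open>q\<close> only counts if
  no run with a smaller code belongs to a different program comparable with \<open>q\<close>.\<close>
definition accepting :: "nat \<Rightarrow> nat \<Rightarrow> nat \<Rightarrow> bool" where
  "accepting e q j \<longleftrightarrow> run e j \<and> p1 j = q \<and> (\<forall>j'<j. run e j' \<and> compat (p1 j') q \<longrightarrow> p1 j' = q)"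

text \<open>The input has the form 1^e 0 q: a unary header naming machine \<open>e = p1 m\<close>,
  followed by a program \<open>q\<close> for it; \<open>p2 m\<close> is the accepting run.\<close>

definition universal_run :: "nat \<Rightarrow> nat \<Rightarrow> bool" where
  "universal_run m b \<longleftrightarrow> p1 m < lenc b \<and> (\<forall>i<p1 m. nthc b i = 1) \<and> nthc b (p1 m) = 0 \<and>
     accepting (p1 m) (dropc (Suc (p1 m)) b) (p2 m)"

lemma dcd_bitsc [cmp_intros]:
  assumes "cmp f"
  shows "dcd (\<lambda>Or x. bitsc (f Or x))"
  unfolding bitsc_def by (intro cmp_intros cmp_comp[OF assms] assms)

lemma dcd_universal_run: "dcd (\<lambda>Or p. universal_run (p1 p) (p2 p))"
  unfolding universal_run_def accepting_def run_def compat_def by (intro cmp_intros)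

lemma run_iff: "(\<exists>m. run (code r) (pr (bcode p) (pr y m))) \<longleftrightarrow> evalp (code r) [bcode p] y"
proof -
  have "consc q 0 = list_encode [q]" for q using consc_list_encode[of q "[]"] by simp
  then show ?thesis by (simp add: run_def evalp_iff_cert bitsc_iff del: list_encode.simps)
qed

lemma universal_run_bcode:
  "universal_run m (bcode p) \<longleftrightarrow>
    (\<exists>q. p = replicate (p1 m) True @ False # q \<and> accepting (p1 m) (bcode q) (p2 m))"
    (is "?l \<longleftrightarrow> ?r")
proof
  assume l: ?l
  let ?e = "p1 m"
  have "p = take ?e p @ p ! ?e # drop (Suc ?e) p"
    using l by (simp add: universal_run_def id_take_nth_drop)
  moreover have "take ?e p = replicate ?e True"
  proof (rule nth_equalityI)
    fix i assume "i < length (take ?e p)"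
    then have "i < ?e" "i < length p" by auto
    with l have "nthc (bcode p) i = 1" by (simp only: universal_run_def)
    then have "p ! i" using \<open>i < length p\<close> by (simp del: One_nat_def)
    then show "take ?e p ! i = replicate ?e True ! i" using \<open>i < ?e\<close> by simp
  qed (use l in \<open>simp add: universal_run_def\<close>)
  moreover have "\<not> p ! ?e" using l by (auto simp: universal_run_def)
  ultimately have "p = replicate ?e True @ False # drop (Suc ?e) p" by simp
  moreover have "accepting ?e (bcode (drop (Suc ?e) p)) (p2 m)"
    using l by (simp add: universal_run_def)
  ultimately show ?r by blast
next
  assume ?r
  then show ?l by (auto simp: universal_run_def nth_append)
qed

text \<open>The unary header is self-delimiting: the first zero ends it. Comparable inputs thus
  address the same machine, and prefix-freeness reduces to that of each filtered machine.\<close>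

lemma replicate_True_append_eq:
  "prefix (replicate e True @ False # q) (replicate e' True @ False # q') \<longleftrightarrow> e = e' \<and> prefix q q'"
proof (induction e arbitrary: e')
  case 0
  then show ?case by (cases e') auto
next
  case (Suc e)
  then show ?case by (cases e') auto
qed

text \<open>Of two different comparable programs, the one with the larger run code is blocked by the
  other; equal run codes contain the same program.\<close>

lemma accepting_prefix_free:
  assumes "accepting e (bcode p) j" "accepting e (bcode q) j'" "prefix p q"
  shows "p = q"
  using assms linorder_cases[of j j'] unfolding accepting_def by (metis bcode_eq_iff compat_bcode)

text \<open>A number coding no program runs as \<open>Z\<close>, which halts on \<open>[]\<close>
  and on \<open>[True]\<close>.\<close>

lemma prefix_machine_imp_code:
  assumes "prefix_machine M"
  obtains r where "M = code r"
proof (cases "\<exists>r. code r = M")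
  case False
  then have "halts_on M p" for p by (auto simp: halts_on_def evalp_def prog_def intro: eval_Z)
  then have "[] = [True]" using assms unfolding prefix_machine_def by (metis Nil_prefix)
  then show thesis by simp
qed (use that in blast)

lemma KM_le: "evalp M [bcode p] y \<Longrightarrow> KM M y \<le> enat (length p)"
  unfolding KM_def by (rule INF_lower) simp

lemma KM_attained:
  assumes "KM M y \<noteq> \<infinity>"
  obtains p where "evalp M [bcode p] y" "KM M y = enat (length p)"
proof -
  let ?A = "(\<lambda>p. enat (length p)) ` {p. evalp M [bcode p] y}"
  have "?A \<noteq> {}" using assms unfolding KM_def Inf_enat_def by metis
  then have "Inf ?A \<in> ?A" unfolding Inf_enat_def by (metis (mono_tags, lifting) LeastI ex_in_conv)
  then have "KM M y \<in> ?A" unfolding KM_def .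
  then show thesis using that by auto
qed

text \<open>Filtering makes every machine prefix-free and takes nothing from one that already is.
  Simulating \<open>M\<close> costs its header, \<open>Suc M\<close> bits.\<close>

lemma optimal_prefix_machine_exists: "\<exists>U. optimal_prefix_machine U"
proof -
  obtain u where u: "\<And>Or b y. eval Or u [b] y \<longleftrightarrow>
      (\<exists>m. universal_run m b \<and> (\<forall>z<m. \<not> universal_run z b) \<and> y = p1 (p2 (p2 m)))"
    by (rule search_program[OF dcd_universal_run cmp_p1[OF cmp_p2[OF cmp_p2[OF cmp_id]]]]) blast
  have evalp_u: "evalp (code u) [b] y \<longleftrightarrow>
      (\<exists>m. universal_run m b \<and> (\<forall>z<m. \<not> universal_run z b) \<and> y = p1 (p2 (p2 m)))" for b y
    by (simp add: evalp_code u)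
  have "prefix_machine (code u)"
    unfolding prefix_machine_def
  proof (intro allI impI)
    fix p q
    assume "halts_on (code u) p" "halts_on (code u) q" and pre: "prefix p q"
    then obtain m m' where "universal_run m (bcode p)" "universal_run m' (bcode q)"
      unfolding halts_on_def evalp_u by blast
    then show "p = q" using pre
      by (auto simp: universal_run_bcode replicate_True_append_eq dest: accepting_prefix_free)
  qed
  moreover have "KM (code u) y \<le> KM M y + enat (Suc M)" if M: "prefix_machine M" for M y
  proof (cases "KM M y = \<infinity>")
    case False
    then obtain p where p: "evalp M [bcode p] y" "KM M y = enat (length p)" by (rule KM_attained)
    obtain r where r: "M = code r" using M by (rule prefix_machine_imp_code)
    from p(1) obtain c where c: "run M (pr (bcode p) (pr y c))" unfolding r by (auto simp: run_iff[symmetric])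
    let ?b = "bcode (replicate M True @ False # p)"
    have halts: "halts_on M p'" if "run M j" "p1 j = bcode p'" for p' j
    proof -
      have "run M (pr (bcode p') (pr (p1 (p2 j)) (p2 (p2 j))))" using that by (metis pr_p1_p2)
      then show ?thesis unfolding r halts_on_def by (metis run_iff)
    qed
    \<comment> \<open>As \<open>M\<close> is prefix-free, no run of a different program is
      comparable with \<open>p\<close>, so the filter lets this run pass.\<close>
    have "halts_on M p" using p(1) by (auto simp: halts_on_def)
    then have "p1 j = bcode p" if j: "run M j" "compat (p1 j) (bcode p)" for j
    proof -
      obtain p' where p': "p1 j = bcode p'" using j(1) by (auto simp: run_def bitsc_iff)
      with j \<open>halts_on M p\<close> halts show ?thesis
        using M unfolding prefix_machine_def by (metis compat_bcode)
    qed
    then have "accepting M (bcode p) (pr (bcode p) (pr y c))" using c by (simp add: accepting_def)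
    then have ex: "universal_run (pr M (pr (bcode p) (pr y c))) ?b" by (auto simp: universal_run_bcode)
    \<comment> \<open>The search may stop at a run other than the one exhibited. Any run on this
      input has header \<open>M\<close> and program \<open>p\<close>, so determinism of
      \<open>M\<close> still yields output \<open>y\<close>.\<close>
    define m where "m = (LEAST m. universal_run m ?b)"
    have m: "universal_run m ?b" "\<forall>z<m. \<not> universal_run z ?b"
      unfolding m_def using LeastI[of "\<lambda>m. universal_run m ?b", OF ex] not_less_Least by blast+
    from m(1) obtain q where "replicate M True @ False # p = replicate (p1 m) True @ False # q"
      "accepting (p1 m) (bcode q) (p2 m)" by (auto simp: universal_run_bcode)
    then have "p1 m = M" "q = p"
      using replicate_True_append_eq[of M p "p1 m" q] replicate_True_append_eq[of "p1 m" q M p]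
      by (auto simp: prefix_order.antisym)
    with \<open>accepting (p1 m) (bcode q) (p2 m)\<close>
    have "run M (pr (bcode p) (pr (p1 (p2 (p2 m))) (p2 (p2 (p2 m)))))"
      unfolding accepting_def by (metis pr_p1_p2)
    then have "evalp M [bcode p] (p1 (p2 (p2 m)))" unfolding r by (metis run_iff)
    then have "p1 (p2 (p2 m)) = y" using p(1) by (rule evalp_deterministic)
    with m have "evalp (code u) [?b] y" unfolding evalp_u by blast
    then show ?thesis using KM_le[of "code u" "replicate M True @ False # p" y] p(2) by (simp add: add.commute)
  qed simp
  ultimately show ?thesis unfolding optimal_prefix_machine_def by blast
qed

lemma optimal_UK: "optimal_prefix_machine UK"
  unfolding UK_def using optimal_prefix_machine_exists by (rule someI_ex)

text \<open>Compare with the machine that halts only on the empty program, of code 0, and outputs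
  \<open>y\<close>. The constant may depend on \<open>y\<close>, as only finiteness is
  wanted.\<close>

lemma KM_UK_finite: "KM UK y \<noteq> \<infinity>"
proof -
  have P: "dcd (\<lambda>Or p. p2 p = 0 \<and> p1 p = y)" by (intro cmp_intros)
  obtain r where r: "\<And>Or x z. eval Or r [x] z \<longleftrightarrow>
      (\<exists>m. (x = 0 \<and> m = y) \<and> (\<forall>z<m. \<not> (x = 0 \<and> z = y)) \<and> z = m)"
    by (rule search_program[of "\<lambda>_ m x. x = 0 \<and> m = y", OF P cmp_id]) blast
  have r': "evalp (code r) [bcode p] z \<longleftrightarrow> p = [] \<and> z = y" for p z
  proof -
    have "bcode p = 0 \<longleftrightarrow> p = []" by (cases p) (simp_all add: bcode_def)
    then show ?thesis by (auto simp: evalp_code r)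
  qed
  then have "prefix_machine (code r)" by (auto simp: prefix_machine_def halts_on_def)
  then obtain c where "KM UK y \<le> KM (code r) y + enat c"
    using optimal_UK unfolding optimal_prefix_machine_def by blast
  moreover have "KM (code r) y \<le> 0" using KM_le[of "code r" "[]" y] r' by (simp add: zero_enat_def)
  ultimately show ?thesis by (cases "KM UK y") auto
qed

section \<open>Refuting a bound on the randomness deficiency\<close>

text \<open>With denominators cleared, this is (max 0 r + 2^-p) * 2^s < 1 for the rational r coded
  by \<open>q\<close>. Even \<open>p1 q\<close> codes a nonnegative numerator; an odd one codes a
  negative numerator, where only \<open>s < p\<close> remains.\<close>

definition below :: "nat \<Rightarrow> nat \<Rightarrow> nat \<Rightarrow> bool" where
  "below q p s \<longleftrightarrow>
     (\<exists>k<Suc (p1 q). p1 q = 2 * k \<and> (k * 2 ^ p + Suc (p2 q)) * 2 ^ s < Suc (p2 q) * 2 ^ p) \<or>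
     (\<exists>k<Suc (p1 q). p1 q = Suc (2 * k) \<and> s < p)"

lemma rat_of_code_eq: "rat_of_code q = real_of_int (int_decode (p1 q)) / real (Suc (p2 q))"
  by (simp add: rat_of_code_def p1_def p2_def split: prod.split)

lemma below_iff: "below q p s \<longleftrightarrow> (max 0 (rat_of_code q) + 1 / 2 ^ p) * 2 ^ s < 1"
proof (cases "even (p1 q)")
  case True
  then obtain k where k: "p1 q = 2 * k" by (elim evenE)
  let ?d = "real (Suc (p2 q))"
  have r: "rat_of_code q = real k / ?d"
    by (simp add: rat_of_code_eq k int_decode_def sum_decode_def)
  have "below q p s \<longleftrightarrow> (k * 2 ^ p + Suc (p2 q)) * 2 ^ s < Suc (p2 q) * 2 ^ p"
    using k by (auto simp: below_def) presburger+
  also have "\<dots> \<longleftrightarrow> real ((k * 2 ^ p + Suc (p2 q)) * 2 ^ s) < real (Suc (p2 q) * 2 ^ p)"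
    by (simp only: of_nat_less_iff)
  also have "\<dots> \<longleftrightarrow> (real k * 2 ^ p + ?d) * 2 ^ s < ?d * 2 ^ p"
    by (simp only: of_nat_mult of_nat_add of_nat_power of_nat_numeral)
  also have "\<dots> \<longleftrightarrow> (real k / ?d + 1 / 2 ^ p) * 2 ^ s < 1"
    by (simp add: field_simps del: of_nat_Suc)
  also have "real k / ?d = max 0 (rat_of_code q)" by (simp add: r max_def)
  finally show ?thesis .
next
  case False
  then obtain k where k: "p1 q = Suc (2 * k)" by (metis oddE Suc_eq_plus1)
  have "rat_of_code q \<le> 0"
    by (simp add: rat_of_code_eq k int_decode_def sum_decode_def divide_nonpos_pos)
  moreover have "below q p s \<longleftrightarrow> s < p"
    using k by (auto simp: below_def) presburger+
  moreover have "(1 / 2 ^ p) * 2 ^ s < (1 :: real) \<longleftrightarrow> s < p"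
    by (simp add: field_simps)
  ultimately show ?thesis by (simp add: max_def)
qed

lemma below_imp_less:
  assumes "below q p s" "\<bar>rat_of_code q - x\<bar> \<le> 1 / 2 ^ p"
  shows "x * 2 ^ s < 1"
proof -
  have "x \<le> max 0 (rat_of_code q) + 1 / 2 ^ p" using assms(2) by linarith
  then have "x * 2 ^ s \<le> (max 0 (rat_of_code q) + 1 / 2 ^ p) * 2 ^ s" by (intro mult_right_mono) auto
  then show ?thesis using assms(1) unfolding below_iff by (rule order.strict_trans1)
qed

lemma less_imp_below:
  assumes "x * 2 ^ s < 1" "0 \<le> x"
  obtains p where "\<And>q. \<bar>rat_of_code q - x\<bar> \<le> 1 / 2 ^ p \<Longrightarrow> below q p s"
proof -
  \<comment> \<open>The approximation may exceed \<open>x\<close> by 2^-p and the test adds 2^-p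
    again; both must fit into the gap 2^-s - x, whence the factor 2.\<close>
  have pos: "0 < (1 - x * 2 ^ s) / (2 * 2 ^ s)" using assms(1) by simp
  obtain p where "(1 / 2 :: real) ^ p < (1 - x * 2 ^ s) / (2 * 2 ^ s)"
    using real_arch_pow_inv[OF pos, of "1 / 2"] by auto
  then have p: "(x + 2 * (1 / 2 ^ p)) * 2 ^ s < 1" by (simp add: field_simps power_one_over)
  show thesis
  proof (rule that[of p])
    fix q assume "\<bar>rat_of_code q - x\<bar> \<le> 1 / 2 ^ p"
    then have "max 0 (rat_of_code q) + 1 / 2 ^ p \<le> x + 2 * (1 / 2 ^ p)" using assms(2) by auto
    then have "(max 0 (rat_of_code q) + 1 / 2 ^ p) * 2 ^ s \<le> (x + 2 * (1 / 2 ^ p)) * 2 ^ s"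
      by (intro mult_right_mono) auto
    then show "below q p s" using p unfolding below_iff by (rule order.strict_trans1)
  qed
qed

text \<open>\<open>w\<close> is a program of length at least K for the initial segment
  \<open>v\<close>, and \<open>q\<close> approximates the measure of \<open>v\<close> to precision
  \<open>p\<close>. Success of \<open>below\<close> puts log(1/\<mu>) above
  \<open>lenc w + c\<close>, so the deficiency at \<open>v\<close> exceeds \<open>c\<close>.\<close>

definition refutes :: "(nat \<Rightarrow> nat) \<Rightarrow> nat \<Rightarrow> nat \<Rightarrow> nat \<Rightarrow> nat \<Rightarrow> nat \<Rightarrow> nat \<Rightarrow> nat \<Rightarrow> nat \<Rightarrow> bool" where
  "refutes X e c v p q t w u \<longleftrightarrow> (\<forall>i<lenc v. nthc v i = X i) \<and>
     cert e (consc v (consc p 0)) q t \<and> bitsc w \<and> cert UK (consc w 0) v u \<and> below q p (lenc w + c)"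

lemma dcd_refutes [cmp_intros]:
  assumes "cmp e" "cmp c" "cmp v" "cmp p" "cmp q" "cmp t" "cmp w" "cmp u"
  shows "dcd (\<lambda>Or x. refutes (Or j) (e Or x) (c Or x) (v Or x) (p Or x) (q Or x) (t Or x) (w Or x) (u Or x))"
  unfolding refutes_def below_def
  by (intro cmp_intros cmp_comp[OF assms(2)] cmp_comp[OF assms(3)]
     cmp_comp[OF assms(4)] cmp_comp[OF assms(5)] cmp_comp[OF assms(7)] assms)

definition refuted :: "(nat \<Rightarrow> nat) \<Rightarrow> nat \<Rightarrow> nat \<Rightarrow> bool" where
  "refuted X e c \<longleftrightarrow> (\<exists>v p q t w u. refutes X e c v p q t w u)"

lemma list_eq_initseg: "(\<forall>i<length xs. xs ! i = X i) \<longleftrightarrow> xs = initseg X (length xs)"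
  unfolding list_eq_iff_nth_eq by (simp add: initseg_def)

text \<open>The inequality is strict, so when true it already shows at some finite precision.
  Quantifying over programs \<open>w\<close> avoids \<open>K\<close>, which can only be approximated
  from above.\<close>

lemma refuted_iff:
  assumes \<mu>: "cyl_measure L \<mu>" "computes_measure L (code r) \<mu>" and X: "\<And>n. X n \<in> L"
  shows "refuted X (code r) c \<longleftrightarrow>
    (\<exists>n w. evalp UK [bcode w] (list_encode (initseg X n)) \<and> \<mu> (initseg X n) * 2 ^ (length w + c) < 1)"
proof -
  obtain k where k: "UK = code k"
    using optimal_UK prefix_machine_imp_code unfolding optimal_prefix_machine_def by blast
  have X': "initseg X n \<in> lists L" for n using X by (auto simp: initseg_def)
  have cons: "consc a 0 = list_encode [a]" for a using consc_list_encode[of a "[]"] by simp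
  show ?thesis
  proof
    assume "refuted X (code r) c"
    then obtain v p q t w u where R: "refutes X (code r) c v p q t w u" unfolding refuted_def by blast
    define n where "n = lenc v"
    have "list_decode v = initseg X n"
      using R list_eq_initseg[of "list_decode v" X] by (simp add: refutes_def n_def nthc_def lenc_def)
    then have v: "v = list_encode (initseg X n)" by (metis list_decode_inverse)
    obtain b where w: "w = bcode b" using R by (auto simp: refutes_def bitsc_iff)
    have "evalp UK [bcode b] v"
      using R unfolding refutes_def k evalp_iff_cert by (auto simp: cons w simp del: list_encode.simps)
    moreover have "evalp (code r) [v, p] q"
      using R unfolding evalp_iff_cert by (auto simp: refutes_def cons simp del: list_encode.simps)
    then have "\<bar>rat_of_code q - \<mu> (initseg X n)\<bar> \<le> 1 / 2 ^ p"
      using \<mu>(2) X'[of n] evalp_deterministic unfolding computes_measure_def v by blast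
    then have "\<mu> (initseg X n) * 2 ^ (length b + c) < 1"
      using R below_imp_less w by (auto simp: refutes_def)
    ultimately show "\<exists>n w. evalp UK [bcode w] (list_encode (initseg X n)) \<and>
        \<mu> (initseg X n) * 2 ^ (length w + c) < 1"
      using v by blast
  next
    assume "\<exists>n w. evalp UK [bcode w] (list_encode (initseg X n)) \<and> \<mu> (initseg X n) * 2 ^ (length w + c) < 1"
    then obtain n w where w: "evalp UK [bcode w] (list_encode (initseg X n))"
      and less: "\<mu> (initseg X n) * 2 ^ (length w + c) < 1" by blast
    let ?v = "list_encode (initseg X n)"
    have "0 \<le> \<mu> (initseg X n)" using \<mu>(1) X'[of n] unfolding cyl_measure_def by blast
    then obtain p where p: "\<And>q. \<bar>rat_of_code q - \<mu> (initseg X n)\<bar> \<le> 1 / 2 ^ p \<Longrightarrow> below q p (length w + c)"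
      using less_imp_below less by metis
    obtain q where q: "evalp (code r) [?v, p] q" "\<bar>rat_of_code q - \<mu> (initseg X n)\<bar> \<le> 1 / 2 ^ p"
      using \<mu>(2) X'[of n] unfolding computes_measure_def by blast
    obtain t where t: "cert (code r) (list_encode [?v, p]) q t" using q(1) evalp_iff_cert by blast
    obtain u where u: "cert UK (list_encode [bcode w]) ?v u" using w evalp_iff_cert unfolding k by blast
    have "\<forall>i<lenc ?v. nthc ?v i = X i" by (simp add: initseg_def)
    then have "refutes X (code r) c ?v p q t (bcode w) u"
      using t u p[OF q(2)] by (auto simp: refutes_def cons bitsc_iff simp del: list_encode.simps)
    then show "refuted X (code r) c" unfolding refuted_def by blast
  qed
qed

text \<open>A bound for all programs is a bound for a shortest one, and the real constant may be
  rounded up to a natural number. Exponentiating removes the logarithm, so the condition makes sense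
  before positivity is known.\<close>

lemma typical_iff:
  "typical \<mu> X \<longleftrightarrow> (\<exists>c::nat. \<forall>n w. evalp UK [bcode w] (list_encode (initseg X n)) \<longrightarrow>
     1 \<le> \<mu> (initseg X n) * 2 ^ (length w + c))"
proof
  assume "typical \<mu> X"
  then obtain c where c: "\<And>n. 0 < \<mu> (initseg X n)"
    "\<And>n. ereal (log 2 (1 / \<mu> (initseg X n))) - ereal_of_enat (K (initseg X n)) \<le> ereal c"
    unfolding typical_def by blast
  obtain d :: nat where d: "c \<le> real d" using real_arch_simple by blast
  have "1 \<le> \<mu> (initseg X n) * 2 ^ (length w + d)"
    if w: "evalp UK [bcode w] (list_encode (initseg X n))" for n w
  proof -
    let ?m = "\<mu> (initseg X n)"
    obtain l where l: "K (initseg X n) = enat l" "l \<le> length w"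
      using KM_le[OF w] KM_UK_finite unfolding K_def by (metis enat_ord_simps(1) not_enat_eq)
    have "log 2 (1 / ?m) \<le> real (length w + d)" using c(2)[of n] d l by simp
    then have "1 / ?m \<le> 2 powr real (length w + d)" using c(1)[of n] by (simp add: log_le_iff)
    then have "1 / ?m \<le> 2 ^ (length w + d)" by (subst (asm) powr_realpow) auto
    then show ?thesis using c(1)[of n] by (simp add: field_simps)
  qed
  then show "\<exists>c::nat. \<forall>n w. evalp UK [bcode w] (list_encode (initseg X n)) \<longrightarrow>
     1 \<le> \<mu> (initseg X n) * 2 ^ (length w + c)" by blast
next
  assume "\<exists>c::nat. \<forall>n w. evalp UK [bcode w] (list_encode (initseg X n)) \<longrightarrow>
     1 \<le> \<mu> (initseg X n) * 2 ^ (length w + c)"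
  then obtain c :: nat where c: "\<And>n w. evalp UK [bcode w] (list_encode (initseg X n)) \<Longrightarrow>
     1 \<le> \<mu> (initseg X n) * 2 ^ (length w + c)" by blast
  have "0 < \<mu> (initseg X n) \<and>
      ereal (log 2 (1 / \<mu> (initseg X n))) - ereal_of_enat (K (initseg X n)) \<le> ereal (real c)" for n
  proof -
    let ?m = "\<mu> (initseg X n)"
    obtain w where w: "evalp UK [bcode w] (list_encode (initseg X n))" "K (initseg X n) = enat (length w)"
      unfolding K_def using KM_attained KM_UK_finite by metis
    have 1: "1 \<le> ?m * 2 ^ (length w + c)" using c w(1) by blast
    have pos: "0 < ?m"
    proof (rule ccontr)
      assume "\<not> 0 < ?m"
      then have "?m * 2 ^ (length w + c) \<le> 0" by (simp add: mult_nonpos_nonneg)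
      with 1 show False by linarith
    qed
    then have "1 / ?m \<le> 2 powr real (length w + c)"
      using 1 by (subst powr_realpow) (simp_all add: field_simps)
    then have "log 2 (1 / ?m) \<le> real (length w + c)" using pos by (simp add: log_le_iff)
    then show ?thesis using pos w(2) by simp
  qed
  then show "typical \<mu> X" unfolding typical_def by blast
qed

text \<open>A number coding no program always returns 0, which codes the rational 0; this misses
  \<open>\<mu> [] = 1\<close> by more than the error 1/2 allowed at precision 1.\<close>

lemma halting_measure_alg_imp_code:
  assumes "halting_measure_alg L e"
  obtains r where "e = code r"
proof (cases "\<exists>r. code r = e")
  case False
  then have "evalp e xs y \<Longrightarrow> y = 0" for xs y
    by (auto simp: evalp_def prog_def elim: eval_ZE)
  moreover obtain \<mu> where \<mu>: "cyl_measure L \<mu>" "computes_measure L e \<mu>"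
    using assms unfolding halting_measure_alg_def by blast
  have "\<mu> [] = 1" using \<mu>(1) unfolding cyl_measure_def by blast
  moreover obtain q where "evalp e [list_encode [], 1] q" "\<bar>rat_of_code q - \<mu> []\<bar> \<le> 1 / 2 ^ 1"
    using \<mu>(2) lists.Nil[of L] unfolding computes_measure_def by blast
  moreover have "rat_of_code 0 = 0"
    by (simp add: rat_of_code_eq int_decode_def sum_decode_def)
  ultimately show thesis by force
qed (use that in blast)

lemma not_refuted_iff_typical:
  assumes "halting_measure_alg L e" and X: "\<And>n. X n \<in> L"
    and "cyl_measure L \<mu>" "computes_measure L e \<mu>"
  shows "(\<exists>c. \<not> refuted X e c) \<longleftrightarrow> typical \<mu> X"
proof -
  obtain r where r: "e = code r" using assms(1) by (rule halting_measure_alg_imp_code)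
  have "\<not> refuted X e c \<longleftrightarrow> (\<forall>n w. evalp UK [bcode w] (list_encode (initseg X n)) \<longrightarrow>
      1 \<le> \<mu> (initseg X n) * 2 ^ (length w + c))" for c
    using refuted_iff[OF assms(3) assms(4)[unfolded r] X] unfolding r
    by (simp only: not_ex de_Morgan_conj not_less imp_conv_disj)
  then show ?thesis by (simp only: typical_iff)
qed

section \<open>Identification in the limit\<close>

text \<open>\<open>m0\<close> passes every finite test, so each stage has a least survivor and the
  program is total. Below the least \<open>m\<close> that is never refuted, only finitely many
  hypotheses have to fall, each at a finite time.\<close>

lemma limit_search:
  assumes B: "dcd (\<lambda>Or p. B Or (p1 p) (p2 p))" and out: "cmp out"
  obtains M where "\<And>Or m0. (\<And>t. \<not> B Or m0 t) \<Longrightarrow>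
    (\<forall>n. \<exists>i. eval Or M [n] i) \<and> (\<exists>m n0. (\<forall>t. \<not> B Or m t) \<and> (\<forall>n\<ge>n0. eval Or M [n] (out Or m)))"
proof -
  define P where "P Or m n \<longleftrightarrow> (\<forall>t<Suc n. \<not> B Or m t)" for Or m n
  have "dcd (\<lambda>Or p. P Or (p1 p) (p2 p))"
    unfolding P_def
    by (intro cmp_intros dcd_comp[OF B, of "\<lambda>Or p. pr (p1 (p2 p)) (p1 p)", simplified])
  then obtain M where M: "\<And>Or n i. eval Or M [n] i \<longleftrightarrow>
      (\<exists>m. P Or m n \<and> (\<forall>z<m. \<not> P Or z n) \<and> i = out Or m)"
    by (rule search_program[OF _ out]) blast
  show thesis
  proof (rule that[of M])
    fix Or m0
    assume m0: "\<And>t. \<not> B Or m0 t"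
    have total: "\<exists>i. eval Or M [n] i" for n
    proof -
      have "P Or m0 n" using m0 by (simp add: P_def)
      then show ?thesis unfolding M using exists_least_iff[of "\<lambda>m. P Or m n"] by blast
    qed
    obtain m where m: "\<And>t. \<not> B Or m t" "\<And>z. z < m \<Longrightarrow> \<exists>t. B Or z t"
      using m0 exists_least_iff[of "\<lambda>m. \<forall>t. \<not> B Or m t"] by blast
    from m(2) obtain t where t: "\<And>z. z < m \<Longrightarrow> B Or z (t z)" by metis
    \<comment> \<open>From the last of these refutation times on, \<open>m\<close> is the least
      survivor; \<open>{0}\<close> keeps the set nonempty when \<open>m = 0\<close>.\<close>
    have "eval Or M [n] (out Or m)" if "Max (t ` {..<m} \<union> {0}) \<le> n" for n
    proof -
      have "t z < Suc n" if "z < m" for z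
        using Max_ge[of "t ` {..<m} \<union> {0}" "t z"] that \<open>Max _ \<le> n\<close> by (auto simp: less_Suc_eq_le)
      then show ?thesis unfolding M using m(1) t by (intro exI[of _ m]) (auto simp: P_def)
    qed
    then show "(\<forall>n. \<exists>i. eval Or M [n] i) \<and>
        (\<exists>m n0. (\<forall>t. \<not> B Or m t) \<and> (\<forall>n\<ge>n0. eval Or M [n] (out Or m)))"
      using total m(1) by blast
  qed
qed

definition refutes_at :: "(nat \<Rightarrow> nat) \<Rightarrow> nat \<Rightarrow> nat \<Rightarrow> nat \<Rightarrow> bool" where
  "refutes_at X e c s \<longleftrightarrow> refutes X e c (p1 s) (p1 (p2 s)) (p1 (p2 (p2 s))) (p1 (p2 (p2 (p2 s))))
     (p1 (p2 (p2 (p2 (p2 s))))) (p2 (p2 (p2 (p2 (p2 s)))))"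

lemma refuted_iff_refutes_at: "refuted X e c \<longleftrightarrow> (\<exists>s. refutes_at X e c s)"
proof
  assume "refuted X e c"
  then obtain v p q t w u where "refutes X e c v p q t w u" unfolding refuted_def by blast
  then have "refutes_at X e c (pr v (pr p (pr q (pr t (pr w u)))))" by (simp add: refutes_at_def)
  then show "\<exists>s. refutes_at X e c s" ..
qed (unfold refuted_def refutes_at_def, blast)

lemma dcd_refutes_at [cmp_intros]:
  "cmp e \<Longrightarrow> cmp c \<Longrightarrow> cmp s \<Longrightarrow> dcd (\<lambda>Or x. refutes_at (Or j) (e Or x) (c Or x) (s Or x))"
  unfolding refutes_at_def by (intro cmp_intros)

text \<open>\<open>idx E m\<close> is the index proposed by hypothesis \<open>m\<close>, which pairs a reference to an index with a
  bound on the deficiency; \<open>bad E m t\<close> says that \<open>t\<close> reveals an index outside \<open>S\<close>.\<close>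
lemma identification:
  fixes idx :: "(nat \<Rightarrow> nat) \<Rightarrow> nat \<Rightarrow> nat" and bad :: "(nat \<Rightarrow> nat) \<Rightarrow> nat \<Rightarrow> nat \<Rightarrow> bool"
  assumes idx: "cmp (\<lambda>Or m. idx (Or 0) m)"
    and bad: "dcd (\<lambda>Or p. bad (Or 0) (p1 p) (p2 p))"
  obtains M where "\<And>S E X. (\<forall>e\<in>S. halting_measure_alg L e) \<Longrightarrow> (\<And>n. X n \<in> L) \<Longrightarrow>
    (\<And>m. idx E m \<in> S \<longleftrightarrow> (\<forall>t. \<not> bad E m t)) \<Longrightarrow>
    (\<And>k c. k \<in> S \<Longrightarrow> \<exists>m. idx E m = k \<and> p2 m = c) \<Longrightarrow>
    \<exists>k\<in>S. \<exists>\<mu>. cyl_measure L \<mu> \<and> computes_measure L k \<mu> \<and> typical \<mu> X \<Longrightarrow>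
    identifies L M S E X"
proof -
  define B where "B Or m t \<longleftrightarrow> refutes_at (Or 1) (idx (Or 0) m) (p2 m) t \<or> bad (Or 0) m t"
    for Or :: "nat \<Rightarrow> nat \<Rightarrow> nat" and m t
  have B: "dcd (\<lambda>Or p. B Or (p1 p) (p2 p))"
    unfolding B_def by (intro cmp_intros cmp_comp[OF idx] bad)
  obtain M where M: "\<And>Or m0. (\<And>t. \<not> B Or m0 t) \<Longrightarrow> (\<forall>n. \<exists>i. eval Or M [n] i) \<and>
      (\<exists>m n0. (\<forall>t. \<not> B Or m t) \<and> (\<forall>n\<ge>n0. eval Or M [n] (idx (Or 0) m)))"
    by (rule limit_search[OF B idx]) blast
  show thesis
  proof (rule that[of M])
    fix S E X
    assume S: "\<forall>e\<in>S. halting_measure_alg L e" and X: "\<And>n. X n \<in> L"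
      and idx_S: "\<And>m. idx E m \<in> S \<longleftrightarrow> (\<forall>t. \<not> bad E m t)"
      and ex: "\<And>k c. k \<in> S \<Longrightarrow> \<exists>m. idx E m = k \<and> p2 m = c"
      and some_typical: "\<exists>k\<in>S. \<exists>\<mu>. cyl_measure L \<mu> \<and> computes_measure L k \<mu> \<and> typical \<mu> X"
    define Or where "Or = (\<lambda>j::nat. if j = 0 then E else X)"
    have good: "(\<forall>t. \<not> B Or m t) \<longleftrightarrow> idx E m \<in> S \<and> \<not> refuted X (idx E m) (p2 m)" for m
      by (auto simp: B_def Or_def idx_S refuted_iff_refutes_at)
    obtain k \<mu> where k: "k \<in> S" "cyl_measure L \<mu>" "computes_measure L k \<mu>" "typical \<mu> X"
      using some_typical by blast
    then obtain c where "\<not> refuted X k c" using not_refuted_iff_typical S X by metis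
    then obtain m0 where "\<forall>t. \<not> B Or m0 t" using ex[OF k(1), of c] k(1) good by metis
    then obtain m n0 where total: "\<forall>n. \<exists>i. eval Or M [n] i" and m: "\<forall>t. \<not> B Or m t"
      and lim: "\<forall>n\<ge>n0. eval Or M [n] (idx E m)"
      using M[of Or m0] by (auto simp: Or_def)
    \<comment> \<open>The limit hypothesis need not be \<open>m0\<close>, nor its index
      \<open>k\<close>. Its index lies in \<open>S\<close>, hence computes some measure, and for
      that measure the absence of a refutation means typicality.\<close>
    have "idx E m \<in> S" "\<not> refuted X (idx E m) (p2 m)" using m good by auto
    moreover obtain \<nu> where "cyl_measure L \<nu>" "computes_measure L (idx E m) \<nu>"
      using S \<open>idx E m \<in> S\<close> unfolding halting_measure_alg_def by blast
    moreover from this have "typical \<nu> X" using not_refuted_iff_typical S X calculation by metis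
    ultimately show "identifies L M S E X"
      unfolding identifies_def Let_def Or_def[symmetric] using total lim by blast
  qed
qed

theorem theorem2:
  fixes L :: "nat set"
  assumes "finite L"
  shows
   "(\<exists>M. \<forall>S E X.
        (\<forall>e\<in>S. halting_measure_alg L e) \<longrightarrow>
        computable1 E \<longrightarrow> range E = S \<longrightarrow>
        (\<forall>n. X n \<in> L) \<longrightarrow>
        (\<exists>k\<in>S. \<exists>\<mu>. cyl_measure L \<mu> \<and> computes_measure L k \<mu> \<and> typical \<mu> X) \<longrightarrow>
        identifies L M S E X)
    \<and>
    (\<exists>M. \<forall>S E X.
        (\<forall>e\<in>S. halting_measure_alg L e) \<longrightarrow>
        computable1 E \<longrightarrow> range E = - S \<longrightarrow>
        (\<forall>n. X n \<in> L) \<longrightarrow>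
        (\<exists>k\<in>S. \<exists>\<mu>. cyl_measure L \<mu> \<and> computes_measure L k \<mu> \<and> typical \<mu> X) \<longrightarrow>
        identifies L M S E X)"
proof
  \<comment> \<open>In the c.e. case a hypothesis refers to a position in the enumeration, so its
    index belongs to \<open>S\<close> automatically and there is nothing to detect.\<close>
  obtain M where M: "\<And>S E X. (\<forall>e\<in>S. halting_measure_alg L e) \<Longrightarrow> (\<And>n. X n \<in> L) \<Longrightarrow>
      (\<And>m. E (p1 m) \<in> S \<longleftrightarrow> (\<forall>t::nat. \<not> False)) \<Longrightarrow>
      (\<And>k c. k \<in> S \<Longrightarrow> \<exists>m. E (p1 m) = k \<and> p2 m = c) \<Longrightarrow>
      \<exists>k\<in>S. \<exists>\<mu>. cyl_measure L \<mu> \<and> computes_measure L k \<mu> \<and> typical \<mu> X \<Longrightarrow>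
      identifies L M S E X"
    by (rule identification[where idx = "\<lambda>E m. E (p1 m)" and bad = "\<lambda>E m t. False" and L = L])
      (intro cmp_intros | simp add: dcd_def cmp_const | blast)+
  have "\<exists>m. E (p1 m) = k \<and> p2 m = c" if "k \<in> range E" for E :: "nat \<Rightarrow> nat" and k c
    using that by (metis imageE p1_pr p2_pr)
  then show "\<exists>M. \<forall>S E X.
        (\<forall>e\<in>S. halting_measure_alg L e) \<longrightarrow>
        computable1 E \<longrightarrow> range E = S \<longrightarrow>
        (\<forall>n. X n \<in> L) \<longrightarrow>
        (\<exists>k\<in>S. \<exists>\<mu>. cyl_measure L \<mu> \<and> computes_measure L k \<mu> \<and> typical \<mu> X) \<longrightarrow>
        identifies L M S E X"
    by (intro exI[of _ M] allI impI M) auto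
next
  \<comment> \<open>In the co-c.e. case a hypothesis names its index outright, and is discarded once
    the enumeration of the complement produces that index.\<close>
  obtain M where M: "\<And>S E X. (\<forall>e\<in>S. halting_measure_alg L e) \<Longrightarrow> (\<And>n. X n \<in> L) \<Longrightarrow>
      (\<And>m. p1 m \<in> S \<longleftrightarrow> (\<forall>t. E t \<noteq> p1 m)) \<Longrightarrow>
      (\<And>k c. k \<in> S \<Longrightarrow> \<exists>m. p1 m = k \<and> p2 m = c) \<Longrightarrow>
      \<exists>k\<in>S. \<exists>\<mu>. cyl_measure L \<mu> \<and> computes_measure L k \<mu> \<and> typical \<mu> X \<Longrightarrow>
      identifies L M S E X"
    by (rule identification[where idx = "\<lambda>E m. p1 m" and bad = "\<lambda>E m t. E t = p1 m" and L = L])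
      (intro cmp_intros | blast)+
  have "p1 m \<in> S \<longleftrightarrow> (\<forall>t. E t \<noteq> p1 m)" if "range E = - S" for E S m
    using that by (metis ComplD ComplI rangeE rangeI)
  moreover have "\<exists>m. p1 m = k \<and> p2 m = c" for k c by (metis p1_pr p2_pr)
  ultimately show "\<exists>M. \<forall>S E X.
        (\<forall>e\<in>S. halting_measure_alg L e) \<longrightarrow>
        computable1 E \<longrightarrow> range E = - S \<longrightarrow>
        (\<forall>n. X n \<in> L) \<longrightarrow>
        (\<exists>k\<in>S. \<exists>\<mu>. cyl_measure L \<mu> \<and> computes_measure L k \<mu> \<and> typical \<mu> X) \<longrightarrow>
        identifies L M S E X"
    by (intro exI[of _ M] allI impI M) auto
qed

end
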